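(* Let $M(t)=\sum_{j=1}^{N(1)}L_j(t-T_j)$, $t\ge 1$, be the Poisson cluster model with a non-homogeneous Poisson process $N$ with mean value function $\Lambda(\cdot)$ and i.i.d. additive cluster processes $L_k$, $k=1,2,\ldots$, whose common law is given by $E[\mathrm{e}^{ixL(t)}]=\exp\{\int_{(0,t]\times\mathbb{R}}(\mathrm{e}^{ixv}-1)\,\nu(\mathrm{d}(u,v))\}$ (full setting in the context). Let $s>0$, $t\ge 1$, $x\in\mathbb{R}$. Then for any Borel set $A$ with $P(M(t)\in A)>0$, the conditional characteristic function of $M(t,t+s]$ given $\{M(t)\in A\}$ is $$E[\mathrm{e}^{ixM(t,t+s]}\mid M(t)\in A]=\frac{E\Big[\exp\Big\{\sum_{j=1}^{N(1)}\int_{(t-V_j,\,t+s-V_j]\times\mathbb{R}}(\mathrm{e}^{ixv}-1)\,\nu(\mathrm{d}(u,v))\Big\}\,P\Big(\sum_{j=1}^{N(1)}L_j(t-V_j)\in A\,\Big|\,N(1),(V_j)\Big)\Big]}{P\Big(\sum_{j=1}^{N(1)}L_j(t-V_j)\in A\Big)},$$ where $(V_j)$ is an i.i.d. sequence with common distribution $F(\mathrm{d}x)=\Lambda(\mathrm{d}x)/\Lambda(1)$, $0\le x\le 1$, such that $(V_j)$, $(L_j)$ and $N$ are mutually independent.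
   Context: Model: $0<T_1<T_2<\cdots$ are the points of a non-homogeneous Poisson process $N$ on $[0,\infty)$ with locally finite mean measure $\Lambda$; $\Lambda(1):=\Lambda[0,1]\in(0,\infty)$ and $N(1)=\#\{j:T_j\le 1\}$. The $L_j$, $j\ge 1$, are i.i.d. copies of an additive process $L$, with $L_j(t)=0$ a.s. for $t\le 0$, and $(T_j)$ and $(L_j)$ are independent. Put $M(t)=\sum_{j=1}^{N(1)}L_j(t-T_j)$ for $t\ge1$ and $M(t,t+s]=M(t+s)-M(t)$. Additive process: stochastically continuous, independent (not necessarily stationary) increments, càdlàg paths, $L(0)=0$ a.s. Here $L$ is of pure jump type: $E[\mathrm{e}^{ixL(t)}]=\exp\{\int_{(0,t]\times\mathbb{R}}(\mathrm{e}^{ixv}-1)\nu(\mathrm{d}(u,v))\}$, where $\nu$ is a measure on $(0,\infty)\times\mathbb{R}$ with $\nu((0,t]\times\{0\})=0$, $\nu(\{t\}\times\mathbb{R})=0$ and $\int_{(0,t]\times\mathbb{R}}(|v|\wedge1)\,\nu(\mathrm{d}(u,v))<\infty$ for all $t$. *)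

theory Defs
  imports "HOL-Probability.Probability"
begin

text \<open>
  Sequences carry the indices \<open>1, 2, \<dots>\<close> of the mathematical text; their entries at
  index \<open>0\<close> are never used.

  The points of a point process on \<open>[0, \<infinity>)\<close> are extended reals: if there are fewer
  than \<open>j\<close> points (possible when the mean measure has finite total mass), then
  \<open>T j = \<infinity>\<close>.
\<close>

definition point_count :: "(nat \<Rightarrow> 'a \<Rightarrow> ereal) \<Rightarrow> real set \<Rightarrow> 'a \<Rightarrow> nat" where
  "point_count T B \<omega> = card {j. 1 \<le> j \<and> T j \<omega> \<in> ereal ` B}"

definition locally_finite_mean_measure :: "real measure \<Rightarrow> bool" where
  "locally_finite_mean_measure \<Lambda> \<longleftrightarrow>
     sets \<Lambda> = sets borel \<and> emeasure \<Lambda> {..<0} = 0 \<and> (\<forall>a. emeasure \<Lambda> {0..a} < \<infinity>)"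

text \<open>
  Diffuseness of \<open>\<Lambda>\<close> and \<open>\<Lambda> {0} = 0\<close> are not assumed; they follow from the
  points being positive and distinct.
\<close>

definition (in prob_space) poisson_process ::
    "real measure \<Rightarrow> (nat \<Rightarrow> 'a \<Rightarrow> ereal) \<Rightarrow> bool" where
  "poisson_process \<Lambda> T \<longleftrightarrow>
     locally_finite_mean_measure \<Lambda> \<and>
     (\<forall>j\<ge>1. random_variable borel (T j)) \<and>
     (AE \<omega> in M. 0 < T 1 \<omega> \<and>
        (\<forall>j\<ge>1. T j \<omega> < T (Suc j) \<omega> \<or> (T j \<omega> = \<infinity> \<and> T (Suc j) \<omega> = \<infinity>))) \<and>
     (AE \<omega> in M. \<forall>a. finite {j. 1 \<le> j \<and> T j \<omega> \<le> ereal a}) \<and>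
     (\<forall>B\<in>sets borel. \<forall>a k. B \<subseteq> {0..a} \<longrightarrow>
        \<P>(\<omega> in M. point_count T B \<omega> = k) =
          measure \<Lambda> B ^ k / fact k * exp (- measure \<Lambda> B)) \<and>
     (\<forall>(n::nat) B a. (\<forall>i<n. B i \<in> sets borel \<and> B i \<subseteq> {0..a}) \<and>
        disjoint_family_on B {..<n} \<longrightarrow>
        indep_vars (\<lambda>_. count_space UNIV) (\<lambda>i. point_count T (B i)) {..<n})"

definition cadlag :: "(real \<Rightarrow> real) \<Rightarrow> bool" where
  "cadlag f \<longleftrightarrow> (\<forall>t. continuous (at_right t) f \<and> (\<exists>l. (f \<longlongrightarrow> l) (at_left t)))"

text \<open>
  An additive process on \<open>[0, \<infinity>)\<close> is regarded as a process on the whole real line that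
  vanishes almost surely at all times \<open>t \<le> 0\<close>; in particular \<open>X 0 = 0\<close> almost surely.
\<close>

definition (in prob_space) additive_process :: "(real \<Rightarrow> 'a \<Rightarrow> real) \<Rightarrow> bool" where
  "additive_process X \<longleftrightarrow>
     (\<forall>t. random_variable borel (X t)) \<and>
     (\<forall>t\<le>0. AE \<omega> in M. X t \<omega> = 0) \<and>
     (\<forall>(n::nat) \<tau>. 0 \<le> \<tau> 0 \<and> (\<forall>i<n. \<tau> i \<le> \<tau> (Suc i)) \<longrightarrow>
        indep_vars (\<lambda>_. borel) (\<lambda>i \<omega>. X (\<tau> (Suc i)) \<omega> - X (\<tau> i) \<omega>) {..<n}) \<and>
     (\<forall>t\<ge>0. \<forall>\<epsilon>>0.
        ((\<lambda>r. \<P>(\<omega> in M. \<bar>X r \<omega> - X t \<omega>\<bar> > \<epsilon>)) \<longlongrightarrow> 0) (at t within {0..})) \<and>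
     (\<forall>\<omega>\<in>space M. cadlag (\<lambda>t. X t \<omega>))"

text \<open>
  A measure on \<open>(0, \<infinity>) \<times> \<real>\<close> is represented by a Borel measure on the plane that does not
  charge \<open>(-\<infinity>, 0] \<times> \<real>\<close>.
\<close>

definition pure_jump_levy_measure :: "(real \<times> real) measure \<Rightarrow> bool" where
  "pure_jump_levy_measure \<nu> \<longleftrightarrow>
     sets \<nu> = sets borel \<and>
     emeasure \<nu> ({..0} \<times> UNIV) = 0 \<and>
     (\<forall>t>0. emeasure \<nu> ({0<..t} \<times> {0}) = 0) \<and>
     (\<forall>t>0. emeasure \<nu> ({t} \<times> UNIV) = 0) \<and>
     (\<forall>t>0. (\<integral>\<^sup>+p\<in>{0<..t} \<times> UNIV. ennreal (min \<bar>snd p\<bar> 1) \<partial>\<nu>) < \<infinity>)"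

definition jump_exponent :: "(real \<times> real) measure \<Rightarrow> real set \<Rightarrow> real \<Rightarrow> complex" where
  "jump_exponent \<nu> I x = (CLINT p:I \<times> UNIV|\<nu>. iexp (x * snd p) - 1)"

text \<open>The time interval \<open>{..1}\<close> gives \<open>N(1)\<close>, the number of points \<open>T j \<le> 1\<close>.\<close>

definition poisson_cluster ::
    "(nat \<Rightarrow> 'a \<Rightarrow> ereal) \<Rightarrow> (nat \<Rightarrow> real \<Rightarrow> 'a \<Rightarrow> real) \<Rightarrow> real \<Rightarrow> 'a \<Rightarrow> real" where
  "poisson_cluster T L t \<omega> =
     (\<Sum>j = 1..point_count T {..1} \<omega>. L j (t - real_of_ereal (T j \<omega>)) \<omega>)"

text \<open>
  Paths of a process are elements of the product space over all times, so the sigma-algebra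
  generated by a process is the one generated by its values at fixed times.
\<close>

abbreviation path_space :: "(real \<Rightarrow> real) measure" where
  "path_space \<equiv> PiM UNIV (\<lambda>_. borel)"

definition (in prob_space) iid :: "'b measure \<Rightarrow> (nat \<Rightarrow> 'a \<Rightarrow> 'b) \<Rightarrow> bool" where
  "iid S X \<longleftrightarrow>
     indep_vars (\<lambda>_. S) X {1..} \<and> (\<forall>j\<ge>1. distr M S (X j) = distr M S (X 1))"

definition seq_sigma :: "'a measure \<Rightarrow> 'b measure \<Rightarrow> (nat \<Rightarrow> 'a \<Rightarrow> 'b) \<Rightarrow> 'a set set" where
  "seq_sigma P S X =
     sets (vimage_algebra (space P) (\<lambda>\<omega>. \<lambda>j\<in>{1..}. X j \<omega>) (PiM {1..} (\<lambda>_. S)))"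

definition (in prob_space) indep_seqs3 ::
    "'b measure \<Rightarrow> (nat \<Rightarrow> 'a \<Rightarrow> 'b) \<Rightarrow> 'c measure \<Rightarrow> (nat \<Rightarrow> 'a \<Rightarrow> 'c) \<Rightarrow>
     'd measure \<Rightarrow> (nat \<Rightarrow> 'a \<Rightarrow> 'd) \<Rightarrow> bool" where
  "indep_seqs3 S X S' Y S'' Z \<longleftrightarrow>
     indep_sets ((!) [seq_sigma M S X, seq_sigma M S' Y, seq_sigma M S'' Z]) {0, 1, 2}"

text \<open>The sub-sigma-algebra generated by \<open>N(1)\<close> and the sequence \<open>V\<close>.\<close>

definition count_marks_algebra ::
    "'a measure \<Rightarrow> (nat \<Rightarrow> 'a \<Rightarrow> ereal) \<Rightarrow> (nat \<Rightarrow> 'a \<Rightarrow> real) \<Rightarrow> 'a measure" where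
  "count_marks_algebra P T V =
     vimage_algebra (space P) (\<lambda>\<omega>. (point_count T {..1} \<omega>, \<lambda>j\<in>{1..}. V j \<omega>))
       (count_space UNIV \<Otimes>\<^sub>M PiM {1..} (\<lambda>_. borel))"

end

theory Submission
  imports Defs
begin

text \<open>
  Multiplying by \<open>P(M(t) \<in> A)\<close>, the claim becomes
  \<open>E (exp (i x M(t, t + s]); M(t) \<in> A) = E (\<Prod>\<^sub>j \<phi>(V\<^sub>j); M'(t) \<in> A)\<close> together with
  \<open>P(M(t) \<in> A) = P(M'(t) \<in> A)\<close>. Here \<open>M'(t) = \<Sum>\<^sub>j L\<^sub>j(t - V\<^sub>j)\<close> is the cluster sum over the sampled points
  and \<open>\<phi>(u)\<close> is the characteristic function at \<open>x\<close> of the cluster increment \<open>L(t + s - u) - L(t - u)\<close>; by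
  \<open>additive_process_increment_char\<close> it is the exponential of the integral in the statement. The product of
  the \<open>\<phi>(V\<^sub>j)\<close> is measurable with respect to \<open>N(1)\<close> and \<open>(V\<^sub>j)\<close>, so the indicator of \<open>M'(t) \<in> A\<close> may be
  replaced by its conditional probability.

  For fixed \<open>x\<close> both sides of the first equation are complex measures in \<open>A\<close>, so it suffices to compare
  their Fourier transforms (\<open>complex_weighted_law_unique\<close>), which turns sums over points into products
  over points. Averaging over the clusters, which are independent of the points
  (\<open>expectation_prod_marks\<close>), leaves \<open>E (\<Prod>\<^sub>j g(T\<^sub>j))\<close> on the left and \<open>E (\<Prod>\<^sub>j g(V\<^sub>j))\<close> on the right. The
  function is the same on both sides, \<open>g(u) = \<phi>(u) E (exp (i y L(t - u)))\<close>: on the left it factors because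
  the increment of a cluster after time \<open>t\<close> is independent of its value at time \<open>t\<close>.

  Finally, a product over all points does not depend on their order. Both expectations equal
  \<open>exp (\<integral> (g - 1) d\<Lambda>)\<close> over \<open>[0, 1]\<close>: for the Poisson points this is the generating functional
  (\<open>poisson_process_functional\<close>), for the sampled points the generating function of the Poisson variable
  \<open>N(1)\<close> (\<open>mixed_binomial_functional\<close>). The order statistics of a Poisson process are thus avoided.
\<close>

section \<open>Freezing and joint measurability\<close>

text \<open>
  The freezing principle. When the first argument of \<open>h\<close> sees only \<open>G\<close> and the second only the
  independent \<open>F\<close>, the pair \<open>(\<omega>, \<omega>)\<close> has a product law on \<open>G \<Otimes>\<^sub>M F\<close>, so the first argument may be held
  fixed while integrating over the second. Working with sub-sigma-algebras instead of random elements
  lets \<open>h\<close> be a path evaluated at a random time, which is not measurable on the path space.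
\<close>
lemma (in prob_space) integral_indep_diagonal:
  fixes h :: "'a \<times> 'a \<Rightarrow> complex"
  assumes G: "subalgebra M G" and F: "subalgebra M F" and ind: "indep_set (sets G) (sets F)"
    and h [measurable]: "h \<in> borel_measurable (G \<Otimes>\<^sub>M F)" and bound: "\<And>p. norm (h p) \<le> 1"
  shows "(\<integral>\<omega>. h (\<omega>, \<omega>) \<partial>M) = (\<integral>\<omega>. (\<integral>\<omega>'. h (\<omega>, \<omega>') \<partial>M) \<partial>M)"
proof -
  have id_measurable: "(\<lambda>\<omega>. \<omega>) \<in> measurable M H"
    and gen: "sigma_sets (space M) {(\<lambda>\<omega>. \<omega>) -` A \<inter> space M | A. A \<in> sets H} = sets H"
    if "subalgebra M H" for H
  proof -
    have sp: "space H = space M" and st: "sets H \<subseteq> sets M"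
      using that by (auto simp: subalgebra_def)
    have "A \<inter> space M = A" if "A \<in> sets H" for A
      using sets.sets_into_space[OF that] sp by auto
    then have eq: "{(\<lambda>\<omega>. \<omega>) -` A \<inter> space M | A. A \<in> sets H} = sets H"
      by (auto simp: vimage_def)
    show "sigma_sets (space M) {(\<lambda>\<omega>. \<omega>) -` A \<inter> space M | A. A \<in> sets H} = sets H"
      unfolding eq using sets.sigma_sets_eq[of H] sp by simp
    show "(\<lambda>\<omega>. \<omega>) \<in> measurable M H"
      using st sp eq by (auto simp: measurable_def vimage_def)
  qed
  note mG [measurable] = id_measurable[OF G] and mF [measurable] = id_measurable[OF F]
  have "indep_var G (\<lambda>\<omega>. \<omega>) F (\<lambda>\<omega>. \<omega>)"
    unfolding indep_var_eq gen[OF G] gen[OF F] using mG mF ind by simp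
  then have prod: "distr M G (\<lambda>\<omega>. \<omega>) \<Otimes>\<^sub>M distr M F (\<lambda>\<omega>. \<omega>) = distr M (G \<Otimes>\<^sub>M F) (\<lambda>\<omega>. (\<omega>, \<omega>))"
    unfolding indep_var_distribution_eq by simp
  interpret DG: prob_space "distr M G (\<lambda>\<omega>. \<omega>)" by (rule prob_space_distr[OF mG])
  interpret DF: prob_space "distr M F (\<lambda>\<omega>. \<omega>)" by (rule prob_space_distr[OF mF])
  interpret DGF: pair_prob_space "distr M G (\<lambda>\<omega>. \<omega>)" "distr M F (\<lambda>\<omega>. \<omega>)" ..
  have hm: "h \<in> borel_measurable (distr M G (\<lambda>\<omega>. \<omega>) \<Otimes>\<^sub>M distr M F (\<lambda>\<omega>. \<omega>))"
    by measurable
  have "(\<integral>\<omega>. h (\<omega>, \<omega>) \<partial>M) = (\<integral>p. h p \<partial>distr M (G \<Otimes>\<^sub>M F) (\<lambda>\<omega>. (\<omega>, \<omega>)))"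
    by (subst integral_distr) auto
  also have "\<dots> = (\<integral>\<omega>. (\<integral>\<omega>'. h (\<omega>, \<omega>') \<partial>distr M F (\<lambda>\<omega>. \<omega>)) \<partial>distr M G (\<lambda>\<omega>. \<omega>))"
    unfolding prod[symmetric]
    by (rule DGF.integral_fst'[symmetric], rule DGF.P.integrable_const_bound[where B=1])
       (use bound hm in auto)
  also have "\<dots> = (\<integral>\<omega>. (\<integral>\<omega>'. h (\<omega>, \<omega>') \<partial>distr M F (\<lambda>\<omega>. \<omega>)) \<partial>M)"
    by (subst integral_distr) auto
  also have "\<dots> = (\<integral>\<omega>. (\<integral>\<omega>'. h (\<omega>, \<omega>') \<partial>M) \<partial>M)"
  proof (rule Bochner_Integration.integral_cong)
    fix \<omega> assume "\<omega> \<in> space M"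
    then have [measurable]: "\<omega> \<in> space G" using G by (simp add: subalgebra_def)
    show "(\<integral>\<omega>'. h (\<omega>, \<omega>') \<partial>distr M F (\<lambda>\<omega>. \<omega>)) = (\<integral>\<omega>'. h (\<omega>, \<omega>') \<partial>M)"
      by (subst integral_distr) auto
  qed simp
  finally show ?thesis .
qed

text \<open>
  The time is rounded up to a grid of mesh \<open>1 / (k + 1)\<close>. On a grid only countably many coordinates
  occur, and right continuity recovers the value in the limit; the rounding is strictly upwards so that
  the limit is one-sided.
\<close>
lemma right_continuous_jointly_measurable:
  fixes X :: "real \<Rightarrow> 'a \<Rightarrow> real"
  assumes X: "\<And>r. X r \<in> borel_measurable F"
    and cont: "\<And>r \<omega>. \<omega> \<in> space F \<Longrightarrow> continuous (at_right r) (\<lambda>r. X r \<omega>)"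
  shows "(\<lambda>p. X (fst p) (snd p)) \<in> borel_measurable (borel \<Otimes>\<^sub>M F)"
proof -
  define d :: "nat \<Rightarrow> real \<Rightarrow> real"
    where "d k r = (of_int \<lfloor>r * real (Suc k)\<rfloor> + 1) / real (Suc k)" for k :: nat and r :: real
  have d_gt: "r < d k r" and d_le: "d k r \<le> r + 1 / Suc k" for k r
  proof -
    define K where "K = real (Suc k)"
    have "0 < K" by (simp add: K_def)
    have "r * K < of_int \<lfloor>r * K\<rfloor> + 1" "of_int \<lfloor>r * K\<rfloor> + 1 \<le> r * K + 1"
      by linarith+
    then have "r < (of_int \<lfloor>r * K\<rfloor> + 1) / K" "(of_int \<lfloor>r * K\<rfloor> + 1) / K \<le> (r * K + 1) / K"
      using \<open>0 < K\<close> by (auto simp: pos_less_divide_eq intro!: divide_right_mono)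
    moreover have "(r * K + 1) / K = r + 1 / K"
      using \<open>0 < K\<close> by (simp add: add_divide_distrib)
    ultimately show "r < d k r" "d k r \<le> r + 1 / Suc k"
      unfolding d_def K_def by simp_all
  qed
  have d_lim: "filterlim (\<lambda>k. d k r) (at_right r) sequentially" for r
  proof (rule tendsto_imp_filterlim_at_right)
    have "(\<lambda>k. r + 1 / Suc k) \<longlonglongrightarrow> r + 0"
      by (intro tendsto_intros) (rule LIMSEQ_Suc[OF lim_1_over_n])
    then have upper: "(\<lambda>k. r + 1 / Suc k) \<longlonglongrightarrow> r" by simp
    show "(\<lambda>k. d k r) \<longlonglongrightarrow> r"
      by (rule real_tendsto_sandwich[OF _ _ tendsto_const upper])
         (simp_all only: d_le less_imp_le[OF d_gt] eventually_True)
  qed (use d_gt in auto)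
  show ?thesis
  proof (rule borel_measurable_LIMSEQ_real)
    fix p :: "real \<times> 'a" assume "p \<in> space (borel \<Otimes>\<^sub>M F)"
    then have "((\<lambda>r. X r (snd p)) \<longlongrightarrow> X (fst p) (snd p)) (at_right (fst p))"
      using cont[of "snd p" "fst p"] by (auto simp: continuous_within space_pair_measure)
    then show "(\<lambda>k. X (d k (fst p)) (snd p)) \<longlonglongrightarrow> X (fst p) (snd p)"
      by (rule filterlim_compose[OF _ d_lim])
  next
    fix k :: nat
    have "(\<lambda>p. (\<lambda>i p. X ((of_int i + 1) / real (Suc k)) (snd p)) \<lfloor>fst p * real (Suc k)\<rfloor> p) \<in> borel_measurable (borel \<Otimes>\<^sub>M F)"
      by (rule measurable_compose_countable) (use X in \<open>measurable\<close>)
    then show "(\<lambda>p. X (d k (fst p)) (snd p)) \<in> borel_measurable (borel \<Otimes>\<^sub>M F)"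
      unfolding d_def by simp
  qed
qed

section \<open>The Poisson generating function\<close>

lemma integral_nat_valued:
  fixes N :: "'a \<Rightarrow> nat" and c :: "nat \<Rightarrow> complex"
  assumes "prob_space M" and N [measurable]: "N \<in> measurable M (count_space UNIV)"
    and bound: "\<And>k. norm (c k) \<le> 1"
  shows "(\<lambda>k. complex_of_real (measure M {\<omega> \<in> space M. N \<omega> = k}) * c k) sums (\<integral>\<omega>. c (N \<omega>) \<partial>M)"
proof -
  interpret prob_space M by fact
  define p where "p k = measure M {\<omega> \<in> space M. N \<omega> = k}" for k
  have p_nonneg: "0 \<le> p k" for k by (simp add: p_def)
  have D: "distr M (count_space UNIV) N = density (count_space UNIV) (\<lambda>k. ennreal (p k))"
  proof (rule measure_eqI_countable[of _ UNIV])
    fix k :: nat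
    have "N -` {k} \<inter> space M = {\<omega> \<in> space M. N \<omega> = k}" by auto
    then show "emeasure (distr M (count_space UNIV) N) {k} =
        emeasure (density (count_space UNIV) (\<lambda>k. ennreal (p k))) {k}"
      by (simp add: emeasure_distr emeasure_density p_def emeasure_eq_measure nn_integral_count_space_indicator)
  qed auto
  interpret D: prob_space "distr M (count_space UNIV) N" by (rule prob_space_distr) simp
  have "integrable (distr M (count_space UNIV) N) c"
    by (rule D.integrable_const_bound[where B=1]) (use bound in auto)
  then have int: "integrable (count_space UNIV) (\<lambda>k. p k *\<^sub>R c k)"
    unfolding D using integrable_density[of c "count_space UNIV" p] by (simp add: p_nonneg)
  have "(\<integral>\<omega>. c (N \<omega>) \<partial>M) = (\<integral>k. c k \<partial>distr M (count_space UNIV) N)"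
    by (subst integral_distr) auto
  also have "\<dots> = (\<integral>k. p k *\<^sub>R c k \<partial>count_space UNIV)"
    unfolding D using integral_density[of c "count_space UNIV" p] by (simp add: p_nonneg)
  finally show ?thesis
    using sums_integral_count_space_nat[OF int] by (simp add: p_def scaleR_conv_of_real)
qed

text \<open>
  The exponential series for \<open>exp (m c)\<close> is the sum over the Poisson weights. The mean \<open>m\<close> may be
  zero, as happens for a set that carries no points.
\<close>
lemma poisson_generating_function:
  fixes N :: "'a \<Rightarrow> nat" and c :: complex
  assumes M: "prob_space M" and N: "N \<in> measurable M (count_space UNIV)"
    and c: "norm c \<le> 1"
    and pois: "\<And>k. measure M {\<omega> \<in> space M. N \<omega> = k} = m ^ k / fact k * exp (- m)"
  shows "(\<integral>\<omega>. c ^ N \<omega> \<partial>M) = exp (of_real m * (c - 1))"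
proof -
  have "(\<lambda>k. complex_of_real (m ^ k / fact k * exp (- m)) * c ^ k) sums (\<integral>\<omega>. c ^ N \<omega> \<partial>M)"
    using integral_nat_valued[OF M N, of "\<lambda>k. c ^ k"] c by (simp add: pois norm_power power_le_one)
  moreover have "(\<lambda>k. exp (- of_real m) * ((of_real m * c) ^ k /\<^sub>R fact k)) sums
      (exp (- of_real m) * exp (of_real m * c) :: complex)"
    by (intro sums_mult exp_converges)
  then have "(\<lambda>k. complex_of_real (m ^ k / fact k * exp (- m)) * c ^ k) sums
      (exp (- of_real m) * exp (of_real m * c))"
    by (simp add: power_mult_distrib scaleR_conv_of_real field_simps exp_of_real[symmetric] flip: of_real_minus)
  ultimately have "(\<integral>\<omega>. c ^ N \<omega> \<partial>M) = exp (- of_real m) * exp (of_real m * c)"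
    by (rule sums_unique2)
  then show ?thesis
    by (simp add: exp_add[symmetric] algebra_simps)
qed

section \<open>Jump exponents\<close>

lemma sets_pure_jump_levy_measure:
  assumes "pure_jump_levy_measure \<nu>"
  shows "sets \<nu> = sets (borel \<Otimes>\<^sub>M borel)"
  using assms unfolding borel_prod by (simp add: pure_jump_levy_measure_def)

text \<open>
  The integrand is at most \<open>\<bar>x v\<bar>\<close> for small jumps and at most 2 for large ones, hence dominated by a
  multiple of \<open>min \<bar>v\<bar> 1\<close>.
\<close>
lemma integrable_jump_integrand:
  assumes \<nu>: "pure_jump_levy_measure \<nu>" and b: "0 \<le> b"
  shows "set_integrable \<nu> ({0<..b} \<times> UNIV) (\<lambda>p. iexp (x * snd p) - 1)"
proof (cases "b = 0")
  case True
  then show ?thesis by (simp add: set_integrable_def)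
next
  case False
  have sets [measurable_cong]: "sets \<nu> = sets (borel \<Otimes>\<^sub>M borel)"
    using sets_pure_jump_levy_measure[OF \<nu>] .
  have box [measurable]: "{0<..b} \<times> (UNIV :: real set) \<in> sets \<nu>"
    unfolding sets by (intro pair_measureI) auto
  have fin: "(\<integral>\<^sup>+p\<in>{0<..b} \<times> UNIV. ennreal (min \<bar>snd p\<bar> 1) \<partial>\<nu>) < \<infinity>"
    using \<nu> False b by (simp add: pure_jump_levy_measure_def)
  have le: "cmod (iexp (x * v) - 1) \<le> (2 + \<bar>x\<bar>) * min \<bar>v\<bar> 1" for v
  proof (cases "\<bar>v\<bar> \<le> 1")
    case True
    have "cmod (iexp (x * v) - 1) \<le> \<bar>x * v\<bar>"
      using iexp_approx1[of "x * v" 0] by simp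
    also have "\<dots> \<le> (2 + \<bar>x\<bar>) * \<bar>v\<bar>" by (simp add: abs_mult mult_right_mono)
    finally show ?thesis using True by (simp add: min_def)
  next
    case False
    have "cmod (iexp (x * v) - 1) \<le> 2"
      using norm_triangle_ineq4[of "iexp (x * v)" 1] by simp
    then show ?thesis using False by (simp add: min_def)
  qed
  have "integrable \<nu> (\<lambda>p. indicator ({0<..b} \<times> UNIV) p * min \<bar>snd p\<bar> 1)"
    using fin by (intro integrableI_bounded)
      (auto simp: ennreal_mult'' ennreal_indicator mult.commute cong: nn_integral_cong)
  then have "integrable \<nu> (\<lambda>p. (2 + \<bar>x\<bar>) * (indicator ({0<..b} \<times> UNIV) p * min \<bar>snd p\<bar> 1))"
    by (rule integrable_mult_right)
  then show ?thesis
    unfolding set_integrable_def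
    by (rule Bochner_Integration.integrable_bound)
       (use le in \<open>auto intro!: AE_I2 simp: indicator_def\<close>)
qed

lemma jump_exponent_split:
  assumes \<nu>: "pure_jump_levy_measure \<nu>" and "0 \<le> a" "a \<le> b"
  shows "jump_exponent \<nu> {0<..b} x = jump_exponent \<nu> {0<..a} x + jump_exponent \<nu> {a<..b} x"
proof -
  have "sets \<nu> = sets (borel \<Otimes>\<^sub>M borel)"
    using sets_pure_jump_levy_measure[OF \<nu>] .
  then have "{a<..b} \<times> (UNIV :: real set) \<in> sets \<nu>" "{0<..a} \<times> (UNIV :: real set) \<in> sets \<nu>"
    by (auto intro!: pair_measureI)
  moreover have int: "set_integrable \<nu> ({0<..b} \<times> UNIV) (\<lambda>p. iexp (x * snd p) - 1)"
    using assms by (intro integrable_jump_integrand[OF \<nu>]) simp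
  ultimately have "set_integrable \<nu> ({0<..a} \<times> UNIV) (\<lambda>p. iexp (x * snd p) - 1)"
    "set_integrable \<nu> ({a<..b} \<times> UNIV) (\<lambda>p. iexp (x * snd p) - 1)"
    using assms by (auto intro!: set_integrable_subset[OF int] simp del: of_real_mult)
  moreover have "{0<..b} \<times> (UNIV :: real set) = {0<..a} \<times> UNIV \<union> {a<..b} \<times> UNIV"
    using assms by auto
  ultimately show ?thesis
    unfolding jump_exponent_def by (simp only:) (rule set_integral_Un, auto)
qed

text \<open>
  Processes are indexed by the whole line and rest before time 0, and \<open>\<nu>\<close> does not charge that
  period. This is what makes the formulas below hold for all real times.
\<close>
lemma jump_exponent_positive_part:
  assumes \<nu>: "pure_jump_levy_measure \<nu>"
  shows "jump_exponent \<nu> {a<..b} x = jump_exponent \<nu> {max a 0<..max b 0} x"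
proof -
  have sets [measurable_cong]: "sets \<nu> = sets (borel \<Otimes>\<^sub>M borel)"
    using sets_pure_jump_levy_measure[OF \<nu>] .
  have [measurable]: "I \<times> (UNIV :: real set) \<in> sets \<nu>" if "I \<in> sets borel" for I :: "real set"
    unfolding sets using that by (intro pair_measureI) auto
  have "{..0} \<times> UNIV \<in> null_sets \<nu>"
    using \<nu> by (auto simp: null_sets_def pure_jump_levy_measure_def)
  then have "AE p in \<nu>. p \<notin> {..0} \<times> UNIV" by (rule AE_not_in)
  then show ?thesis
    unfolding jump_exponent_def set_lebesgue_integral_def
    by (intro integral_cong_AE) (auto simp: indicator_def less_max_iff_disj le_max_iff_disj)
qed

section \<open>Characteristic functions of additive processes\<close>

lemma (in prob_space) additive_process_values:
  assumes "additive_process X"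
  shows "X r \<in> borel_measurable M" "AE \<omega> in M. X r \<omega> = X (max r 0) \<omega>"
    "r \<le> 0 \<Longrightarrow> AE \<omega> in M. X r \<omega> = 0"
proof -
  show rv: "X r \<in> borel_measurable M" and z: "r \<le> 0 \<Longrightarrow> AE \<omega> in M. X r \<omega> = 0" for r
    using assms by (auto simp: additive_process_def)
  show "AE \<omega> in M. X r \<omega> = X (max r 0) \<omega>"
  proof (cases "r \<le> 0")
    case True
    then show ?thesis using z[of r] z[of 0] by (simp add: max_def) auto
  qed (simp add: max_def)
qed

text \<open>
  For \<open>0 \<le> a\<close> this is the independence of the increments over \<open>(0, a]\<close> and \<open>(a, b]\<close>. Negative times
  are moved to 0, where the process has the same value almost surely.
\<close>
lemma (in prob_space) additive_process_exp_increment: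
  assumes X: "additive_process X" and "a \<le> b"
  shows "expectation (\<lambda>\<omega>. iexp (x * (X b \<omega> - X a \<omega>)) * iexp (y * X a \<omega>)) =
     expectation (\<lambda>\<omega>. iexp (x * (X b \<omega> - X a \<omega>))) * expectation (\<lambda>\<omega>. iexp (y * X a \<omega>))"
proof -
  note [measurable] = additive_process_values(1)[OF X]
  let ?a = "max a 0" and ?b = "max b 0"
  have AE: "AE \<omega> in M. X a \<omega> = X ?a \<omega> \<and> X b \<omega> = X ?b \<omega> \<and> X 0 \<omega> = 0"
    using additive_process_values(2)[OF X, of a] additive_process_values(2)[OF X, of b]
      additive_process_values(3)[OF X, of 0] by auto
  define \<tau> where "\<tau> i = (if i = 0 then 0 else if i = 1 then ?a else ?b)" for i :: nat
  define Y where "Y i z = iexp ((if i = 0 then y else x) * z)" for i :: nat and z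
  have "indep_vars (\<lambda>_. borel) (\<lambda>i \<omega>. X (\<tau> (Suc i)) \<omega> - X (\<tau> i) \<omega>) {..<2}"
  proof -
    have "0 \<le> \<tau> 0 \<and> (\<forall>i<2. \<tau> i \<le> \<tau> (Suc i))"
      using \<open>a \<le> b\<close> by (auto simp: \<tau>_def less_2_cases_iff)
    with X show ?thesis unfolding additive_process_def by blast
  qed
  then have ind: "indep_vars (\<lambda>_. borel) (\<lambda>i \<omega>. Y i (X (\<tau> (Suc i)) \<omega> - X (\<tau> i) \<omega>)) {..<2}"
    by (rule indep_vars_compose2) (simp add: Y_def)
  have "expectation (\<lambda>\<omega>. \<Prod>i<2. Y i (X (\<tau> (Suc i)) \<omega> - X (\<tau> i) \<omega>)) =
      (\<Prod>i<2. expectation (\<lambda>\<omega>. Y i (X (\<tau> (Suc i)) \<omega> - X (\<tau> i) \<omega>)))"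
    using ind by (intro indep_vars_lebesgue_integral integrable_const_bound[where B=1])
      (auto simp: Y_def simp del: of_real_mult of_real_diff)
  then have prod: "expectation (\<lambda>\<omega>. iexp (x * (X ?b \<omega> - X ?a \<omega>)) * iexp (y * (X ?a \<omega> - X 0 \<omega>))) =
     expectation (\<lambda>\<omega>. iexp (x * (X ?b \<omega> - X ?a \<omega>))) * expectation (\<lambda>\<omega>. iexp (y * (X ?a \<omega> - X 0 \<omega>)))"
    by (simp add: Y_def \<tau>_def numeral_2_eq_2 mult.commute)
  have "expectation (\<lambda>\<omega>. iexp (x * (X b \<omega> - X a \<omega>)) * iexp (y * X a \<omega>)) =
     expectation (\<lambda>\<omega>. iexp (x * (X ?b \<omega> - X ?a \<omega>)) * iexp (y * (X ?a \<omega> - X 0 \<omega>)))"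
    using AE by (intro integral_cong_AE) auto
  also note prod
  also have "expectation (\<lambda>\<omega>. iexp (x * (X ?b \<omega> - X ?a \<omega>))) = expectation (\<lambda>\<omega>. iexp (x * (X b \<omega> - X a \<omega>)))"
    using AE by (intro integral_cong_AE) auto
  also have "expectation (\<lambda>\<omega>. iexp (y * (X ?a \<omega> - X 0 \<omega>))) = expectation (\<lambda>\<omega>. iexp (y * X a \<omega>))"
    using AE by (intro integral_cong_AE) auto
  finally show ?thesis .
qed

text \<open>
  The characteristic function of \<open>X b\<close> factors over the increments, and that of \<open>X a\<close>, being an
  exponential and so nonzero, may be cancelled.
\<close>
lemma (in prob_space) additive_process_increment_char:
  assumes X: "additive_process X" and \<nu>: "pure_jump_levy_measure \<nu>"
    and char: "\<And>r y. 0 \<le> r \<Longrightarrow> char (distr M borel (X r)) y = exp (jump_exponent \<nu> {0<..r} y)"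
    and "a \<le> b"
  shows "expectation (\<lambda>\<omega>. iexp (x * (X b \<omega> - X a \<omega>))) = exp (jump_exponent \<nu> {a<..b} x)"
    and "expectation (\<lambda>\<omega>. iexp (x * X a \<omega>)) = exp (jump_exponent \<nu> {0<..a} x)"
proof -
  note [measurable] = additive_process_values(1)[OF X]
  have E: "expectation (\<lambda>\<omega>. iexp (x * X r \<omega>)) = exp (jump_exponent \<nu> {0<..r} x)" for r
  proof -
    have "expectation (\<lambda>\<omega>. iexp (x * X r \<omega>)) = expectation (\<lambda>\<omega>. iexp (x * X (max r 0) \<omega>))"
      using additive_process_values(2)[OF X, of r] by (intro integral_cong_AE) auto
    also have "\<dots> = char (distr M borel (X (max r 0))) x"
      unfolding char_def by (subst integral_distr) auto
    also have "\<dots> = exp (jump_exponent \<nu> {0<..max r 0} x)" by (rule char) simp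
    also have "{0<..max r 0} = {0<..r}" by auto
    finally show ?thesis .
  qed
  show "expectation (\<lambda>\<omega>. iexp (x * X a \<omega>)) = exp (jump_exponent \<nu> {0<..a} x)" by (rule E)
  have "expectation (\<lambda>\<omega>. iexp (x * (X b \<omega> - X a \<omega>))) * expectation (\<lambda>\<omega>. iexp (x * X a \<omega>)) =
      expectation (\<lambda>\<omega>. iexp (x * (X b \<omega> - X a \<omega>)) * iexp (x * X a \<omega>))"
    using additive_process_exp_increment[OF X \<open>a \<le> b\<close>, of x x] by simp
  also have "\<dots> = expectation (\<lambda>\<omega>. iexp (x * X b \<omega>))"
    by (simp add: exp_add[symmetric] algebra_simps)
  also have "\<dots> = exp (jump_exponent \<nu> {0<..max b 0} x)"
    unfolding E by (rule arg_cong[where f="\<lambda>I. exp (jump_exponent \<nu> I x)"]) auto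
  also have "\<dots> = exp (jump_exponent \<nu> {0<..max a 0} x + jump_exponent \<nu> {max a 0<..max b 0} x)"
    using \<open>a \<le> b\<close> by (subst jump_exponent_split[OF \<nu>, of "max a 0"]) auto
  also have "\<dots> = exp (jump_exponent \<nu> {a<..b} x) * exp (jump_exponent \<nu> {0<..max a 0} x)"
    unfolding jump_exponent_positive_part[OF \<nu>, of a b] by (simp add: exp_add)
  also have "{0<..max a 0} = {0<..a}" by auto
  finally show "expectation (\<lambda>\<omega>. iexp (x * (X b \<omega> - X a \<omega>))) = exp (jump_exponent \<nu> {a<..b} x)"
    unfolding E by simp
qed

section \<open>Products over a random number of marked points\<close>

lemma measurable_prod_random_length:
  fixes f :: "nat \<Rightarrow> 'a \<Rightarrow> complex"
  assumes N: "N \<in> measurable M (count_space UNIV)" and f: "\<And>j. 1 \<le> j \<Longrightarrow> f j \<in> borel_measurable M"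
  shows "(\<lambda>\<omega>. \<Prod>j = 1..N \<omega>. f j \<omega>) \<in> borel_measurable M"
proof -
  have "(\<lambda>\<omega>. \<Prod>j = 1..n. f j \<omega>) \<in> borel_measurable M" for n :: nat
    using f by (intro borel_measurable_prod) auto
  from measurable_compose_countable[OF this N] show ?thesis .
qed

lemma norm_prod_le_1:
  fixes f :: "'i \<Rightarrow> complex"
  assumes "\<And>i. i \<in> I \<Longrightarrow> norm (f i) \<le> 1"
  shows "norm (\<Prod>i\<in>I. f i) \<le> 1"
  using assms by (simp add: prod_norm[symmetric] prod_le_1)

text \<open>
  Once the number \<open>N\<close> and the points \<open>U j\<close> are frozen, the factors are independent and the expectation
  of the product splits, so each mark may be replaced by its mean \<open>g\<close> at the point.
\<close>
lemma (in prob_space) expectation_prod_marks: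
  fixes K :: "nat \<Rightarrow> real \<Rightarrow> 'a \<Rightarrow> complex" and U :: "nat \<Rightarrow> 'a \<Rightarrow> real"
  assumes G: "subalgebra M G" and F: "subalgebra M F" and ind: "indep_set (sets G) (sets F)"
    and N [measurable]: "N \<in> measurable G (count_space UNIV)"
    and U: "\<And>j. 1 \<le> j \<Longrightarrow> U j \<in> borel_measurable G"
    and K: "\<And>j. 1 \<le> j \<Longrightarrow> (\<lambda>p. K j (fst p) (snd p)) \<in> borel_measurable (borel \<Otimes>\<^sub>M F)"
    and K_le: "\<And>j u \<omega>. norm (K j u \<omega>) \<le> 1"
    and K_indep: "\<And>u. indep_vars (\<lambda>_. borel) (\<lambda>j. K j (u j)) {1..}"
    and g: "\<And>j u. 1 \<le> j \<Longrightarrow> expectation (K j u) = g u"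
  shows "expectation (\<lambda>\<omega>. \<Prod>j = 1..N \<omega>. K j (U j \<omega>) \<omega>) = expectation (\<lambda>\<omega>. \<Prod>j = 1..N \<omega>. g (U j \<omega>))"
proof -
  define h where "h p = (\<Prod>j = 1..N (fst p). K j (U j (fst p)) (snd p))" for p
  have "(\<lambda>p. K j (U j (fst p)) (snd p)) \<in> borel_measurable (G \<Otimes>\<^sub>M F)" if "1 \<le> j" for j
  proof -
    have [measurable]: "U j \<in> borel_measurable G" by (rule U[OF that])
    have "(\<lambda>p. (U j (fst p), snd p)) \<in> measurable (G \<Otimes>\<^sub>M F) (borel \<Otimes>\<^sub>M F)" by measurable
    from measurable_compose[OF this K[OF that]] show ?thesis by simp
  qed
  then have h: "h \<in> borel_measurable (G \<Otimes>\<^sub>M F)"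
    unfolding h_def by (intro measurable_prod_random_length) measurable
  have h_le: "norm (h p) \<le> 1" for p
    unfolding h_def by (intro norm_prod_le_1 K_le)
  have "expectation (\<lambda>\<omega>. \<Prod>j = 1..N \<omega>. K j (U j \<omega>) \<omega>) = (\<integral>\<omega>. h (\<omega>, \<omega>) \<partial>M)"
    by (simp add: h_def)
  also have "\<dots> = (\<integral>\<omega>. (\<integral>\<omega>'. h (\<omega>, \<omega>') \<partial>M) \<partial>M)"
    by (rule integral_indep_diagonal[OF G F ind h h_le])
  also have "\<dots> = expectation (\<lambda>\<omega>. \<Prod>j = 1..N \<omega>. g (U j \<omega>))"
  proof (rule Bochner_Integration.integral_cong[OF refl])
    fix \<omega>
    have iv: "indep_vars (\<lambda>_. borel) (\<lambda>j. K j (U j \<omega>)) {1..N \<omega>}"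
      by (rule indep_vars_subset[OF K_indep[of "\<lambda>j. U j \<omega>"]]) auto
    then have "(\<integral>\<omega>'. (\<Prod>j = 1..N \<omega>. K j (U j \<omega>) \<omega>') \<partial>M) =
        (\<Prod>j = 1..N \<omega>. \<integral>\<omega>'. K j (U j \<omega>) \<omega>' \<partial>M)"
      by (intro indep_vars_lebesgue_integral integrable_const_bound[where B=1])
         (use K_le in \<open>auto simp: indep_vars_def\<close>)
    then show "(\<integral>\<omega>'. h (\<omega>, \<omega>') \<partial>M) = (\<Prod>j = 1..N \<omega>. g (U j \<omega>))"
      by (simp add: h_def g)
  qed
  finally show ?thesis .
qed

section \<open>Uniqueness of weighted laws\<close>

text \<open>
  A positive weight, normalised to mean 1, is the density of a new probability measure. The hypothesis
  says that \<open>X\<close> and \<open>Y\<close> have the same characteristic function under the measures weighted by \<open>V\<close> and \<open>W\<close>;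
  at \<open>y = 0\<close> it says that the normalising constants agree. The bounds 1 and 3 fit the weights
  \<open>2 + Re z\<close> with \<open>norm z \<le> 1\<close>.
\<close>
lemma (in prob_space) weighted_law_unique:
  fixes X Y :: "'a \<Rightarrow> real" and V W :: "'a \<Rightarrow> real"
  assumes [measurable]: "X \<in> borel_measurable M" "Y \<in> borel_measurable M"
      "V \<in> borel_measurable M" "W \<in> borel_measurable M"
    and V: "\<And>\<omega>. 1 \<le> V \<omega> \<and> V \<omega> \<le> 3" and W: "\<And>\<omega>. 1 \<le> W \<omega> \<and> W \<omega> \<le> 3"
    and eq: "\<And>y. expectation (\<lambda>\<omega>. of_real (V \<omega>) * iexp (y * X \<omega>)) = expectation (\<lambda>\<omega>. of_real (W \<omega>) * iexp (y * Y \<omega>))"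
    and A [measurable]: "A \<in> sets borel"
  shows "expectation (\<lambda>\<omega>. V \<omega> * indicator A (X \<omega>)) = expectation (\<lambda>\<omega>. W \<omega> * indicator A (Y \<omega>))"
proof -
  define c where "c = expectation V"
  have int: "integrable M D" if [measurable]: "D \<in> borel_measurable M"
    and D: "\<And>\<omega>. 1 \<le> D \<omega> \<and> D \<omega> \<le> 3" for D :: "'a \<Rightarrow> real"
  proof (rule integrable_const_bound[where B=3])
    have "\<bar>D \<omega>\<bar> \<le> 3" for \<omega> using D[of \<omega>] by linarith
    then show "AE \<omega> in M. norm (D \<omega>) \<le> 3" by simp
  qed simp
  have "complex_of_real (expectation V) = complex_of_real (expectation W)"
    using eq[of 0] by simp
  then have cW: "c = expectation W" by (simp add: c_def)
  have "1 \<le> c"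
    using integral_mono[OF _ int[OF _ V], of "\<lambda>_. 1"] V by (simp add: c_def prob_space)
  define law where "law D Z = distr (density M (\<lambda>\<omega>. ennreal (D \<omega> / c))) borel Z" for D Z :: "'a \<Rightarrow> real"
  have rd: "real_distribution (law D Z)"
    and ch: "char (law D Z) y = expectation (\<lambda>\<omega>. of_real (D \<omega>) * iexp (y * Z \<omega>)) / c"
    and ms: "measure (law D Z) A = expectation (\<lambda>\<omega>. D \<omega> * indicator A (Z \<omega>)) / c"
    if [measurable]: "D \<in> borel_measurable M" "Z \<in> borel_measurable M"
      and D: "\<And>\<omega>. 1 \<le> D \<omega> \<and> D \<omega> \<le> 3" and cD: "c = expectation D" for D Z y
  proof -
    have D0: "0 \<le> D \<omega>" for \<omega> using D[of \<omega>] by linarith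
    have iD: "integrable M D" using D by (intro int) auto
    have "emeasure (density M (\<lambda>\<omega>. ennreal (D \<omega> / c))) (space M) = ennreal (expectation (\<lambda>\<omega>. D \<omega> / c))"
      using iD D0 \<open>1 \<le> c\<close> by (simp add: emeasure_density nn_integral_eq_integral cong: nn_integral_cong_simp)
    also have "\<dots> = 1"
      using \<open>1 \<le> c\<close> by (simp add: cD[symmetric])
    finally interpret Dn: prob_space "density M (\<lambda>\<omega>. ennreal (D \<omega> / c))"
      by (intro prob_spaceI) simp
    show "real_distribution (law D Z)"
      unfolding law_def by (rule Dn.real_distribution_distr) simp
    have "char (law D Z) y = (\<integral>\<omega>. iexp (y * Z \<omega>) \<partial>density M (\<lambda>\<omega>. ennreal (D \<omega> / c)))"
      unfolding char_def law_def by (subst integral_distr) auto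
    also have "\<dots> = (\<integral>\<omega>. (D \<omega> / c) *\<^sub>R iexp (y * Z \<omega>) \<partial>M)"
      using D0 \<open>1 \<le> c\<close> by (subst integral_density) auto
    also have "\<dots> = (\<integral>\<omega>. of_real (D \<omega>) * iexp (y * Z \<omega>) / of_real c \<partial>M)"
      by (simp add: scaleR_conv_of_real)
    finally show "char (law D Z) y = expectation (\<lambda>\<omega>. of_real (D \<omega>) * iexp (y * Z \<omega>)) / c"
      by simp
    have "measure (law D Z) A = (\<integral>z. indicator A z \<partial>law D Z)"
      by (simp add: law_def)
    also have "\<dots> = (\<integral>\<omega>. indicator A (Z \<omega>) \<partial>density M (\<lambda>\<omega>. ennreal (D \<omega> / c)))"
      unfolding law_def by (subst integral_distr) auto
    also have "\<dots> = (\<integral>\<omega>. D \<omega> * indicator A (Z \<omega>) / c \<partial>M)"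
      using D0 \<open>1 \<le> c\<close> by (subst integral_density) auto
    finally show "measure (law D Z) A = expectation (\<lambda>\<omega>. D \<omega> * indicator A (Z \<omega>)) / c"
      by simp
  qed
  have "law V X = law W Y"
  proof (rule Levy_uniqueness)
    show "real_distribution (law V X)" "real_distribution (law W Y)"
      using V W cW c_def by (auto intro!: rd)
    show "char (law V X) = char (law W Y)"
    proof
      fix y
      have "char (law V X) y = expectation (\<lambda>\<omega>. of_real (V \<omega>) * iexp (y * X \<omega>)) / c"
        using V c_def by (intro ch) auto
      also have "\<dots> = char (law W Y) y"
        unfolding eq using W cW by (intro ch[symmetric]) auto
      finally show "char (law V X) y = char (law W Y) y" .
    qed
  qed
  then have "expectation (\<lambda>\<omega>. V \<omega> * indicator A (X \<omega>)) / c = expectation (\<lambda>\<omega>. W \<omega> * indicator A (Y \<omega>)) / c"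
    using ms[of V X] ms[of W Y] V W cW c_def by auto
  then show ?thesis using \<open>1 \<le> c\<close> by simp
qed

text \<open>
  Uniqueness for the complex measures \<open>A \<mapsto> E (V; X \<in> A)\<close>, reduced to the positive case. Both \<open>2 + Re V\<close>
  and the constant 2 are positive weights, and subtracting their equations leaves \<open>Re V\<close>; the imaginary
  part is the real part of \<open>-\<i> V\<close>.
\<close>
lemma (in prob_space) complex_weighted_law_unique:
  fixes X Y :: "'a \<Rightarrow> real" and V W :: "'a \<Rightarrow> complex"
  assumes [measurable]: "X \<in> borel_measurable M" "Y \<in> borel_measurable M"
      "V \<in> borel_measurable M" "W \<in> borel_measurable M"
    and V: "\<And>\<omega>. norm (V \<omega>) \<le> 1" and W: "\<And>\<omega>. norm (W \<omega>) \<le> 1"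
    and weighted: "\<And>y. expectation (\<lambda>\<omega>. V \<omega> * iexp (y * X \<omega>)) = expectation (\<lambda>\<omega>. W \<omega> * iexp (y * Y \<omega>))"
    and plain: "\<And>y. expectation (\<lambda>\<omega>. iexp (y * X \<omega>)) = expectation (\<lambda>\<omega>. iexp (y * Y \<omega>))"
    and A [measurable]: "A \<in> sets borel"
  shows "expectation (\<lambda>\<omega>. V \<omega> * indicator A (X \<omega>)) = expectation (\<lambda>\<omega>. W \<omega> * indicator A (Y \<omega>))"
proof -
  have int1: "integrable M (\<lambda>\<omega>. D \<omega> * iexp (y * Z \<omega>))"
    and int2: "integrable M (\<lambda>\<omega>. iexp (y * Z \<omega>))"
    and int3: "integrable M (\<lambda>\<omega>. D \<omega> * indicator A (Z \<omega>))"
    and int4: "integrable M (\<lambda>\<omega>. 2 * indicator A (Z \<omega>) :: real)"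
    and int5: "integrable M (\<lambda>\<omega>. Re (D \<omega>) * indicator A (Z \<omega>))"
    if [measurable]: "D \<in> borel_measurable M" "Z \<in> borel_measurable M" and D: "\<And>\<omega>. norm (D \<omega>) \<le> 1"
    for D :: "'a \<Rightarrow> complex" and Z :: "'a \<Rightarrow> real" and y
  proof -
    have Re: "\<bar>Re (D \<omega>)\<bar> \<le> 1" for \<omega>
      using abs_Re_le_cmod[of "D \<omega>"] D[of \<omega>] by linarith
    show "integrable M (\<lambda>\<omega>. D \<omega> * iexp (y * Z \<omega>))" "integrable M (\<lambda>\<omega>. iexp (y * Z \<omega>))"
      "integrable M (\<lambda>\<omega>. D \<omega> * indicator A (Z \<omega>))" "integrable M (\<lambda>\<omega>. Re (D \<omega>) * indicator A (Z \<omega>))"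
      by (rule integrable_const_bound[where B=1];
          simp add: norm_mult D Re indicator_def del: of_real_mult)+
    show "integrable M (\<lambda>\<omega>. 2 * indicator A (Z \<omega>) :: real)"
      by (rule integrable_const_bound[where B=2]; simp add: indicator_def)
  qed
  \<comment> \<open>The equation of Fourier transforms is inherited by the conjugate weights, hence by their real parts.\<close>
  have real: "expectation (\<lambda>\<omega>. Re (V \<omega>) * indicator A (X \<omega>)) = expectation (\<lambda>\<omega>. Re (W \<omega>) * indicator A (Y \<omega>))"
    if [measurable]: "V \<in> borel_measurable M" "W \<in> borel_measurable M"
      and V: "\<And>\<omega>. norm (V \<omega>) \<le> 1" and W: "\<And>\<omega>. norm (W \<omega>) \<le> 1"
      and weighted: "\<And>y. expectation (\<lambda>\<omega>. V \<omega> * iexp (y * X \<omega>)) = expectation (\<lambda>\<omega>. W \<omega> * iexp (y * Y \<omega>))"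
    for V W :: "'a \<Rightarrow> complex"
  proof -
    have conj: "expectation (\<lambda>\<omega>. cnj (D \<omega>) * iexp (y * Z \<omega>)) = cnj (expectation (\<lambda>\<omega>. D \<omega> * iexp (- y * Z \<omega>)))"
      for D :: "'a \<Rightarrow> complex" and Z :: "'a \<Rightarrow> real" and y
    proof -
      have "(\<lambda>\<omega>. cnj (D \<omega>) * iexp (y * Z \<omega>)) = (\<lambda>\<omega>. cnj (D \<omega> * iexp (- y * Z \<omega>)))"
        by (simp add: exp_cnj)
      then show ?thesis by (simp only: Bochner_Integration.integral_cnj)
    qed
    have expand: "expectation (\<lambda>\<omega>. of_real (2 + Re (D \<omega>)) * iexp (y * Z \<omega>)) =
        2 * expectation (\<lambda>\<omega>. iexp (y * Z \<omega>)) + expectation (\<lambda>\<omega>. D \<omega> * iexp (y * Z \<omega>)) / 2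
          + cnj (expectation (\<lambda>\<omega>. D \<omega> * iexp (- y * Z \<omega>))) / 2"
      if [measurable]: "D \<in> borel_measurable M" "Z \<in> borel_measurable M" and D: "\<And>\<omega>. norm (D \<omega>) \<le> 1"
      for D :: "'a \<Rightarrow> complex" and Z :: "'a \<Rightarrow> real" and y
    proof -
      have cnj_D: "(\<lambda>\<omega>. cnj (D \<omega>)) \<in> borel_measurable M"
        by (rule measurable_compose[OF that(1)])
          (intro borel_measurable_continuous_onI continuous_intros)
      have Re: "complex_of_real (2 + Re z) = 2 + z / 2 + cnj z / 2" for z
        by (simp add: complex_eq_iff)
      have "expectation (\<lambda>\<omega>. of_real (2 + Re (D \<omega>)) * iexp (y * Z \<omega>)) =
        expectation (\<lambda>\<omega>. 2 * iexp (y * Z \<omega>) + D \<omega> * iexp (y * Z \<omega>) / 2 + cnj (D \<omega>) * iexp (y * Z \<omega>) / 2)"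
        unfolding Re by (simp add: algebra_simps)
      also have "\<dots> = 2 * expectation (\<lambda>\<omega>. iexp (y * Z \<omega>)) + expectation (\<lambda>\<omega>. D \<omega> * iexp (y * Z \<omega>)) / 2
          + expectation (\<lambda>\<omega>. cnj (D \<omega>) * iexp (y * Z \<omega>)) / 2"
        using int1[of D Z y] int1[of "\<lambda>\<omega>. cnj (D \<omega>)" Z y] int2[of D Z y] cnj_D D
        by (simp del: of_real_mult)
      finally show ?thesis unfolding conj .
    qed
    have bnd: "1 \<le> 2 + Re z \<and> 2 + Re z \<le> 3" if "norm z \<le> 1" for z
      using abs_Re_le_cmod[of z] that by auto
    have "expectation (\<lambda>\<omega>. (2 + Re (V \<omega>)) * indicator A (X \<omega>)) = expectation (\<lambda>\<omega>. (2 + Re (W \<omega>)) * indicator A (Y \<omega>))"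
    proof (rule weighted_law_unique)
      fix y
      show "expectation (\<lambda>\<omega>. of_real (2 + Re (V \<omega>)) * iexp (y * X \<omega>)) =
          expectation (\<lambda>\<omega>. of_real (2 + Re (W \<omega>)) * iexp (y * Y \<omega>))"
        using V W by (simp only: expand \<open>X \<in> _\<close> \<open>Y \<in> _\<close> that(1,2) weighted plain)
    qed (use bnd V W in auto)
    moreover have "expectation (\<lambda>\<omega>. 2 * indicator A (X \<omega>)) = expectation (\<lambda>\<omega>. 2 * indicator A (Y \<omega>) :: real)"
      by (rule weighted_law_unique) (use plain in \<open>auto simp del: of_real_mult\<close>)
    ultimately show ?thesis
      using int4[of V X] int4[of W Y] int5[of V X] int5[of W Y] V W by (simp add: distrib_right)
  qed
  have Re_ind: "Re (z * indicator A u) = Re z * indicator A u"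
    and Im_ind: "Im (z * indicator A u) = Re (- \<i> * z) * indicator A u" for z u
    by (simp_all add: indicator_def)
  have re: "expectation (\<lambda>\<omega>. Re (V \<omega> * indicator A (X \<omega>))) = expectation (\<lambda>\<omega>. Re (W \<omega> * indicator A (Y \<omega>)))"
    unfolding Re_ind by (rule real) (use V W weighted in auto)
  have im: "expectation (\<lambda>\<omega>. Im (V \<omega> * indicator A (X \<omega>))) = expectation (\<lambda>\<omega>. Im (W \<omega> * indicator A (Y \<omega>)))"
    unfolding Im_ind
    by (rule real) (use V W weighted in \<open>auto simp: norm_mult mult.assoc simp del: of_real_mult\<close>)
  have "integrable M (\<lambda>\<omega>. V \<omega> * indicator A (X \<omega>))" "integrable M (\<lambda>\<omega>. W \<omega> * indicator A (Y \<omega>))"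
    using V W by (auto intro: int3)
  with re im show ?thesis
    by (simp only: complex_eq_iff Bochner_Integration.integral_Re[symmetric]
        Bochner_Integration.integral_Im[symmetric] simp_thms)
qed

section \<open>Generating functionals of point processes\<close>

lemma (in prob_space) poisson_process_count_law:
  assumes "poisson_process \<Lambda> T" "B \<in> sets borel" "B \<subseteq> {0..a}"
  shows "measure M {\<omega> \<in> space M. point_count T B \<omega> = k} =
    measure \<Lambda> B ^ k / fact k * exp (- measure \<Lambda> B)"
  using assms unfolding poisson_process_def by blast

lemma (in prob_space) poisson_process_indep_counts:
  fixes n :: nat
  assumes "poisson_process \<Lambda> T" "\<And>i. i < n \<Longrightarrow> B i \<in> sets borel \<and> B i \<subseteq> {0..a}"
    and "disjoint_family_on B {..<n}"
  shows "indep_vars (\<lambda>_. count_space UNIV) (\<lambda>i. point_count T (B i)) {..<n}"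
proof -
  have "\<forall>(n::nat) B a. (\<forall>i<n. B i \<in> sets borel \<and> B i \<subseteq> {0..a}) \<and> disjoint_family_on B {..<n} \<longrightarrow>
      indep_vars (\<lambda>_. count_space UNIV) (\<lambda>i. point_count T (B i)) {..<n}"
    using assms(1) unfolding poisson_process_def by (elim conjE)
  from this[rule_format, of n B a] show ?thesis using assms(2,3) by simp
qed

text \<open>
  The points increase and only finitely many of them are at most 1, so the indices of these form a
  finite initial segment. This identifies the sum over \<open>j = 1, ..., N(1)\<close> with the sum
  over the points up to time 1.
\<close>
lemma (in prob_space) poisson_process_points:
  assumes T: "poisson_process \<Lambda> T"
  shows "AE \<omega> in M. (\<forall>j\<ge>1. 0 < T j \<omega>) \<and>
    {j. 1 \<le> j \<and> T j \<omega> \<in> ereal ` {..1}} = {1..point_count T {..1} \<omega>}"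
proof -
  have pos: "AE \<omega> in M. 0 < T 1 \<omega> \<and>
        (\<forall>j\<ge>1. T j \<omega> < T (Suc j) \<omega> \<or> (T j \<omega> = \<infinity> \<and> T (Suc j) \<omega> = \<infinity>))"
    and fin: "AE \<omega> in M. \<forall>a. finite {j. 1 \<le> j \<and> T j \<omega> \<le> ereal a}"
    using T unfolding poisson_process_def by blast+
  from pos fin show ?thesis
  proof eventually_elim
    fix \<omega>
    assume A: "0 < T 1 \<omega> \<and> (\<forall>j\<ge>1. T j \<omega> < T (Suc j) \<omega> \<or> (T j \<omega> = \<infinity> \<and> T (Suc j) \<omega> = \<infinity>))"
      and F: "\<forall>a. finite {j. 1 \<le> j \<and> T j \<omega> \<le> ereal a}"
    have step: "T j \<omega> \<le> T (Suc j) \<omega>" if "1 \<le> j" for j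
      using A that by (metis less_imp_le order_refl)
    have mono: "T i \<omega> \<le> T j \<omega>" if "1 \<le> i" "i \<le> j" for i j
      using that(2,1)
    proof (induction j rule: dec_induct)
      case (step n)
      then show ?case using \<open>\<And>j. 1 \<le> j \<Longrightarrow> T j \<omega> \<le> T (Suc j) \<omega>\<close>[of n] by (auto intro: order_trans)
    qed simp
    have T_pos: "0 < T j \<omega>" if "1 \<le> j" for j
      using A mono[of 1 j] that by (auto intro: less_le_trans)
    define S where "S = {j. 1 \<le> j \<and> T j \<omega> \<in> ereal ` {..1}}"
    have S_eq: "S = {j. 1 \<le> j \<and> T j \<omega> \<le> 1}"
    proof -
      have "T j \<omega> \<in> ereal ` {..1} \<longleftrightarrow> T j \<omega> \<le> 1" if "1 \<le> j" for j
        using T_pos[OF that] by (cases "T j \<omega>") (auto simp: one_ereal_def)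
      then show ?thesis by (auto simp: S_def)
    qed
    have finS: "finite S"
      using F[rule_format, of 1] by (simp add: S_eq one_ereal_def)
    have "S = {1..card S}"
    proof (cases "S = {}")
      case False
      define m where "m = Max S"
      have "m \<in> S" using finS False by (simp add: m_def)
      have "S = {1..m}"
      proof (intro equalityI subsetI)
        fix j assume "j \<in> S" then show "j \<in> {1..m}"
          using finS by (auto simp: m_def S_eq)
      next
        fix j assume "j \<in> {1..m}" then show "j \<in> S"
          using mono[of j m] \<open>m \<in> S\<close> by (auto simp: S_eq intro: order_trans)
      qed
      then show ?thesis by simp
    qed simp
    then show "(\<forall>j\<ge>1. 0 < T j \<omega>) \<and>
      {j. 1 \<le> j \<and> T j \<omega> \<in> ereal ` {..1}} = {1..point_count T {..1} \<omega>}"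
      using T_pos by (simp add: S_def point_count_def)
  qed
qed

lemma measurable_point_count:
  assumes T: "\<And>j. 1 \<le> j \<Longrightarrow> T j \<in> borel_measurable G" and B: "B \<in> sets borel"
  shows "point_count T B \<in> measurable G (count_space UNIV)"
proof -
  have "ereal ` B = real_of_ereal -` B \<inter> space borel - {\<infinity>, -\<infinity>}"
  proof (intro equalityI subsetI)
    fix e assume "e \<in> real_of_ereal -` B \<inter> space borel - {\<infinity>, -\<infinity>}"
    then show "e \<in> ereal ` B" by (cases e) auto
  qed auto
  also have "\<dots> \<in> sets borel"
    using B by (intro sets.Diff measurable_sets[of real_of_ereal borel borel]) auto
  finally have "ereal ` B \<in> sets borel" .
  then have "Measurable.pred G (\<lambda>\<omega>. T j \<omega> \<in> ereal ` B)" if "1 \<le> j" for j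
    using T[OF that] by (intro pred_sets2) auto
  then have "Measurable.pred G (\<lambda>\<omega>. 1 \<le> j \<and> T j \<omega> \<in> ereal ` B)" for j
    by (cases "1 \<le> j") simp_all
  then show ?thesis
    unfolding point_count_def by measurable
qed

text \<open>
  For a simple \<open>g\<close> the product over the points equals the product of \<open>c ^ N(g = c)\<close> over the values \<open>c\<close> of
  \<open>g\<close>. The counts \<open>N(g = c)\<close> are independent Poisson variables, whose generating functions multiply to
  the exponential.
\<close>
lemma (in prob_space) poisson_process_functional_simple:
  fixes g :: "real \<Rightarrow> complex"
  assumes T: "poisson_process \<Lambda> T" and g: "simple_function borel g" and g_le: "\<And>u. norm (g u) \<le> 1"
  shows "expectation (\<lambda>\<omega>. \<Prod>j = 1..point_count T {..1} \<omega>. g (real_of_ereal (T j \<omega>))) =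
    exp (CLINT u:{0..1}|\<Lambda>. g u - 1)"
proof -
  have \<Lambda>: "sets \<Lambda> = sets borel" "emeasure \<Lambda> {0..1} < \<infinity>"
    and T_meas: "\<And>j. 1 \<le> j \<Longrightarrow> T j \<in> borel_measurable M"
    using T unfolding poisson_process_def locally_finite_mean_measure_def by auto
  note [measurable_cong] = \<Lambda>(1)
  have g_meas [measurable]: "g \<in> borel_measurable borel"
    using g by (rule borel_measurable_simple_function)
  obtain c :: "nat \<Rightarrow> complex" and n where c: "bij_betw c {..<n} (range g)"
    using ex_bij_betw_nat_finite[of "range g"] g by (auto simp: simple_function_def atLeast0LessThan)
  then have c_inj: "inj_on c {..<n}" and c_range: "c ` {..<n} = range g"
    by (auto simp: bij_betw_def)
  define B where "B i = {0..1} \<inter> g -` {c i}" for i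
  have B [measurable]: "B i \<in> sets borel" for i
    using measurable_sets[OF g_meas, of "{c i}"] by (simp add: B_def)
  have B_sub: "B i \<subseteq> {0..1}" for i by (simp add: B_def)
  have disj: "disjoint_family_on B {..<n}"
    using c_inj by (auto simp: disjoint_family_on_def B_def inj_on_def)
  have c_le: "norm (c i) \<le> 1" if "i < n" for i
    using c_range g_le that by (metis image_eqI lessThan_iff rangeE)
  have ind: "indep_vars (\<lambda>_. count_space UNIV) (\<lambda>i. point_count T (B i)) {..<n}"
    using B B_sub disj by (intro poisson_process_indep_counts[OF T, where a=1]) auto
  have pois: "measure M {\<omega> \<in> space M. point_count T (B i) \<omega> = k} =
      measure \<Lambda> (B i) ^ k / fact k * exp (- measure \<Lambda> (B i))" for i k
    by (rule poisson_process_count_law[OF T B B_sub])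
  have N [measurable]: "point_count T (B i) \<in> measurable M (count_space UNIV)" for i
    by (rule measurable_point_count[OF T_meas B])
  \<comment> \<open>The points in \<open>[0, 1]\<close> are grouped by the value of \<open>g\<close>.\<close>
  have group: "AE \<omega> in M. (\<Prod>j = 1..point_count T {..1} \<omega>. g (real_of_ereal (T j \<omega>))) =
      (\<Prod>i<n. c i ^ point_count T (B i) \<omega>)"
    using poisson_process_points[OF T]
  proof eventually_elim
    fix \<omega>
    define S where "S = {j. 1 \<le> j \<and> T j \<omega> \<in> ereal ` {..1}}"
    define f where "f j = g (real_of_ereal (T j \<omega>))" for j
    assume *: "(\<forall>j\<ge>1. 0 < T j \<omega>) \<and> {j. 1 \<le> j \<and> T j \<omega> \<in> ereal ` {..1}} = {1..point_count T {..1} \<omega>}"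
    then have S: "S = {1..point_count T {..1} \<omega>}" by (simp add: S_def)
    have fib: "{j \<in> S. f j = c i} = {j. 1 \<le> j \<and> T j \<omega> \<in> ereal ` B i}" for i
    proof -
      have "T j \<omega> \<in> ereal ` B i \<longleftrightarrow> T j \<omega> \<in> ereal ` {..1} \<and> g (real_of_ereal (T j \<omega>)) = c i"
        if "1 \<le> j" for j
        using *[THEN conjunct1, rule_format, OF that] by (cases "T j \<omega>") (auto simp: B_def)
      then show ?thesis by (auto simp: S_def f_def)
    qed
    have "(\<Prod>j\<in>S. f j) = (\<Prod>z\<in>range g. \<Prod>j\<in>{j \<in> S. f j = z}. f j)"
      using g by (intro prod.group[symmetric]) (auto simp: S f_def simple_function_def)
    also have "\<dots> = (\<Prod>i<n. \<Prod>j\<in>{j \<in> S. f j = c i}. f j)"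
      by (rule prod.reindex_bij_betw[OF c, symmetric])
    also have "\<dots> = (\<Prod>i<n. c i ^ card {j \<in> S. f j = c i})"
      by simp
    also have "\<dots> = (\<Prod>i<n. c i ^ point_count T (B i) \<omega>)"
      unfolding fib point_count_def ..
    finally show "(\<Prod>j = 1..point_count T {..1} \<omega>. g (real_of_ereal (T j \<omega>))) =
      (\<Prod>i<n. c i ^ point_count T (B i) \<omega>)"
      by (simp add: S f_def)
  qed
  have T_real: "(\<lambda>\<omega>. g (real_of_ereal (T j \<omega>))) \<in> borel_measurable M" if "1 \<le> j" for j
    using T_meas[OF that] by measurable
  have "expectation (\<lambda>\<omega>. \<Prod>j = 1..point_count T {..1} \<omega>. g (real_of_ereal (T j \<omega>))) =
      expectation (\<lambda>\<omega>. \<Prod>i<n. c i ^ point_count T (B i) \<omega>)"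
    using group
    by (intro integral_cong_AE measurable_prod_random_length measurable_point_count T_meas T_real) auto
  also have "\<dots> = (\<Prod>i<n. expectation (\<lambda>\<omega>. c i ^ point_count T (B i) \<omega>))"
  proof (rule indep_vars_lebesgue_integral)
    show "indep_vars (\<lambda>_. borel) (\<lambda>i \<omega>. c i ^ point_count T (B i) \<omega>) {..<n}"
      by (rule indep_vars_compose2[OF ind, where Y="\<lambda>i k. c i ^ k"]) simp
    fix i assume "i \<in> {..<n}"
    then show "integrable M (\<lambda>\<omega>. c i ^ point_count T (B i) \<omega>)"
      using c_le[of i] by (intro integrable_const_bound[where B=1])
        (auto simp: norm_power power_le_one)
  qed simp
  also have "\<dots> = (\<Prod>i<n. exp (of_real (measure \<Lambda> (B i)) * (c i - 1)))"
    by (intro prod.cong refl poisson_generating_function[OF prob_space_axioms N] c_le pois) simp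
  also have "\<dots> = exp (\<Sum>i<n. of_real (measure \<Lambda> (B i)) * (c i - 1))"
    by (simp add: exp_sum)
  also have "(\<Sum>i<n. of_real (measure \<Lambda> (B i)) * (c i - 1)) = (CLINT u:{0..1}|\<Lambda>. g u - 1)"
  proof -
    have B_fin: "emeasure \<Lambda> (B i) < \<infinity>" for i
      using emeasure_mono[OF B_sub, of \<Lambda> i] \<Lambda> by (auto simp: less_top[symmetric] top_unique)
    have eq: "indicator {0..1} u *\<^sub>R (g u - 1) = (\<Sum>i<n. indicator (B i) u *\<^sub>R (c i - 1))" for u
    proof (cases "u \<in> {0..1}")
      case True
      obtain i where i: "i < n" "g u = c i" using c_range by (metis imageE lessThan_iff rangeI)
      have "(\<Sum>k<n. indicator (B k) u *\<^sub>R (c k - 1)) = (\<Sum>k<n. if k = i then c i - 1 else 0)"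
        using True i c_inj by (intro sum.cong) (auto simp: B_def indicator_def inj_on_def)
      then show ?thesis using True i by simp
    qed (auto simp: B_def)
    have "(CLINT u:{0..1}|\<Lambda>. g u - 1) = (\<integral>u. (\<Sum>i<n. indicator (B i) u *\<^sub>R (c i - 1)) \<partial>\<Lambda>)"
      unfolding set_lebesgue_integral_def eq ..
    also have "\<dots> = (\<Sum>i<n. \<integral>u. indicator (B i) u *\<^sub>R (c i - 1) \<partial>\<Lambda>)"
      using B_fin by (intro Bochner_Integration.integral_sum) auto
    also have "\<dots> = (\<Sum>i<n. of_real (measure \<Lambda> (B i)) * (c i - 1))"
      using B_fin by (simp add: scaleR_conv_of_real)
    finally show ?thesis ..
  qed
  finally show ?thesis .
qed

text \<open>
  The probability generating functional of a Poisson process, obtained from simple functions by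
  dominated convergence: all products and their limits are bounded by 1.
\<close>
lemma (in prob_space) poisson_process_functional:
  fixes g :: "real \<Rightarrow> complex"
  assumes T: "poisson_process \<Lambda> T" and g: "g \<in> borel_measurable borel" and g_le: "\<And>u. norm (g u) \<le> 1"
  shows "expectation (\<lambda>\<omega>. \<Prod>j = 1..point_count T {..1} \<omega>. g (real_of_ereal (T j \<omega>))) =
    exp (CLINT u:{0..1}|\<Lambda>. g u - 1)"
proof -
  have \<Lambda>: "sets \<Lambda> = sets borel" "emeasure \<Lambda> {0..1} < \<infinity>"
    and T_meas: "\<And>j. 1 \<le> j \<Longrightarrow> T j \<in> borel_measurable M"
    using T unfolding poisson_process_def locally_finite_mean_measure_def by auto
  note [measurable_cong] = \<Lambda>(1) and [measurable] = g
  obtain s where s: "\<And>k. simple_function borel (s k)" "\<And>u. (\<lambda>k. s k u) \<longlonglongrightarrow> g u"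
    using borel_measurable_implies_sequence_metric[OF g, of 0] by auto
  \<comment> \<open>Radial projection to the unit disc keeps the approximations simple and bounded by 1.\<close>
  define r :: "complex \<Rightarrow> complex" where "r z = z /\<^sub>R max 1 (norm z)" for z
  define h where "h k u = r (s k u)" for k u
  have h_simple: "simple_function borel (h k)" for k
    unfolding h_def by (rule simple_function_compose1[OF s(1)])
  have h_le: "norm (h k u) \<le> 1" for k u
    by (simp add: h_def r_def field_simps)
  have h_lim: "(\<lambda>k. h k u) \<longlonglongrightarrow> g u" for u
  proof -
    have "(\<lambda>k. h k u) \<longlonglongrightarrow> g u /\<^sub>R max 1 (norm (g u))"
      unfolding h_def r_def by (intro tendsto_intros s(2)) simp
    then show ?thesis using g_le[of u] by (simp add: max_absorb1)
  qed
  have h_meas [measurable]: "h k \<in> borel_measurable borel" for k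
    using h_simple by (rule borel_measurable_simple_function)
  have meas: "(\<lambda>\<omega>. \<Prod>j = 1..point_count T {..1} \<omega>. f (real_of_ereal (T j \<omega>))) \<in> borel_measurable M"
    if [measurable]: "f \<in> borel_measurable borel" for f :: "real \<Rightarrow> complex"
  proof (intro measurable_prod_random_length measurable_point_count T_meas)
    fix j :: nat assume "1 \<le> j"
    from T_meas[OF this] show "(\<lambda>\<omega>. f (real_of_ereal (T j \<omega>))) \<in> borel_measurable M" by measurable
  qed auto
  have lhs: "(\<lambda>k. expectation (\<lambda>\<omega>. \<Prod>j = 1..point_count T {..1} \<omega>. h k (real_of_ereal (T j \<omega>)))) \<longlonglongrightarrow>
      expectation (\<lambda>\<omega>. \<Prod>j = 1..point_count T {..1} \<omega>. g (real_of_ereal (T j \<omega>)))"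
    by (rule integral_dominated_convergence[where w="\<lambda>_. 1"])
       (auto intro!: meas tendsto_prod h_lim AE_I2 norm_prod_le_1 h_le simp del: One_nat_def)
  have one: "integrable \<Lambda> (\<lambda>u. indicator {0..1} u * 2 :: real)"
    using \<Lambda> by (intro integrable_mult_left integrable_real_indicator) auto
  have rhs: "(\<lambda>k. exp (CLINT u:{0..1}|\<Lambda>. h k u - 1)) \<longlonglongrightarrow> exp (CLINT u:{0..1}|\<Lambda>. g u - 1)"
    unfolding set_lebesgue_integral_def
  proof (intro tendsto_exp integral_dominated_convergence[OF _ _ one] AE_I2)
    show "(\<lambda>k. indicator {0..1} u *\<^sub>R (h k u - 1)) \<longlonglongrightarrow> indicator {0..1} u *\<^sub>R (g u - 1)" for u
      by (intro tendsto_intros h_lim)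
    show "norm (indicator {0..1} u *\<^sub>R (h k u - 1)) \<le> indicator {0..1} u * 2" for k u
      using norm_triangle_ineq4[of "h k u" 1] h_le[of k u] by (simp split: split_indicator)
  qed measurable
  show ?thesis
    using LIMSEQ_unique[OF lhs] rhs poisson_process_functional_simple[OF T h_simple h_le] by simp
qed

lemma integral_uniform_measure:
  fixes f :: "'a \<Rightarrow> complex"
  assumes [measurable]: "B \<in> sets M" "f \<in> borel_measurable M"
    and B: "0 < emeasure M B" "emeasure M B < \<infinity>"
  shows "(\<integral>u. f u \<partial>uniform_measure M B) = (\<integral>u. indicator B u *\<^sub>R f u \<partial>M) / measure M B"
proof -
  define m where "m = measure M B"
  have m: "0 < m" "emeasure M B = ennreal m"
    using B by (auto simp: m_def measure_def enn2real_positive_iff)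
  have "uniform_measure M B = density M (\<lambda>u. ennreal (indicator B u / m))"
    unfolding uniform_measure_def m(2) using m(1)
    by (intro density_cong) (auto split: split_indicator simp: divide_ennreal[symmetric])
  then have "(\<integral>u. f u \<partial>uniform_measure M B) = (\<integral>u. (indicator B u / m) *\<^sub>R f u \<partial>M)"
    using m(1) by (simp add: integral_density)
  also have "\<dots> = (\<integral>u. (indicator B u *\<^sub>R f u) / m \<partial>M)"
    by (intro Bochner_Integration.integral_cong) (auto simp: scaleR_conv_of_real)
  finally show ?thesis by (simp add: m_def)
qed

text \<open>
  Given \<open>N\<close> the product has mean \<open>c ^ N\<close>, where \<open>c\<close> is the mean of \<open>g\<close> under \<open>\<Lambda> / \<Lambda>(1)\<close>, and the
  generating function of \<open>N\<close> gives the value found for the Poisson process itself. Equality of the two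
  functionals takes the place of the order statistics property.
\<close>
lemma (in prob_space) mixed_binomial_functional:
  fixes g :: "real \<Rightarrow> complex" and V :: "nat \<Rightarrow> 'a \<Rightarrow> real"
  assumes G: "subalgebra M G" and H: "subalgebra M H" and ind: "indep_set (sets G) (sets H)"
    and N: "N \<in> measurable G (count_space UNIV)"
    and V_meas: "\<And>j. 1 \<le> j \<Longrightarrow> V j \<in> borel_measurable H"
    and V_indep: "indep_vars (\<lambda>_. borel) V {1..}"
    and V_law: "\<And>j. 1 \<le> j \<Longrightarrow> distr M borel (V j) = uniform_measure \<Lambda> {0..1}"
    and \<Lambda>: "sets \<Lambda> = sets borel" "0 < emeasure \<Lambda> {0..1}" "emeasure \<Lambda> {0..1} < \<infinity>"
    and pois: "\<And>k. measure M {\<omega> \<in> space M. N \<omega> = k} =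
      measure \<Lambda> {0..1} ^ k / fact k * exp (- measure \<Lambda> {0..1})"
    and g: "g \<in> borel_measurable borel" and g_le: "\<And>u. norm (g u) \<le> 1"
  shows "expectation (\<lambda>\<omega>. \<Prod>j = 1..N \<omega>. g (V j \<omega>)) = exp (CLINT u:{0..1}|\<Lambda>. g u - 1)"
proof -
  define m where "m = measure \<Lambda> {0..1}"
  have m: "0 < m"
    using \<Lambda> by (simp add: m_def measure_def enn2real_positive_iff)
  define c where "c = (CLINT u:{0..1}|\<Lambda>. g u) / m"
  note [measurable_cong] = \<Lambda>(1) and [measurable] = g
  have Eg: "expectation (\<lambda>\<omega>. g (V j \<omega>)) = c" if j: "1 \<le> j" for j
  proof -
    have [measurable]: "V j \<in> borel_measurable M"
      using measurable_from_subalg[OF H V_meas[OF j]] .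
    have "expectation (\<lambda>\<omega>. g (V j \<omega>)) = (\<integral>u. g u \<partial>uniform_measure \<Lambda> {0..1})"
      unfolding V_law[OF j, symmetric] by (subst integral_distr) auto
    also have "\<dots> = (\<integral>u. indicator {0..1} u *\<^sub>R g u \<partial>\<Lambda>) / m"
      unfolding m_def using \<Lambda> by (intro integral_uniform_measure) auto
    finally show ?thesis by (simp add: c_def set_lebesgue_integral_def)
  qed
  have c_le: "norm c \<le> 1"
  proof -
    have "norm c = norm (expectation (\<lambda>\<omega>. g (V 1 \<omega>)))" by (simp add: Eg)
    also have "\<dots> \<le> expectation (\<lambda>\<omega>. norm (g (V 1 \<omega>)))" by (rule integral_norm_bound)
    also have "\<dots> \<le> 1"
      using measurable_from_subalg[OF H V_meas[of 1]] g_le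
      by (intro integral_le_const integrable_const_bound[where B=1]) auto
    finally show ?thesis .
  qed
  \<comment> \<open>The sampled points act as marks with the constant mean \<open>c\<close>; the locations that carry them are all put at 0.\<close>
  have "expectation (\<lambda>\<omega>. \<Prod>j = 1..N \<omega>. g (V j \<omega>)) = expectation (\<lambda>\<omega>. \<Prod>j = 1..N \<omega>. c)"
  proof (rule expectation_prod_marks[OF G H ind N, where U="\<lambda>_ _. 0" and K="\<lambda>j _ \<omega>. g (V j \<omega>)" and g="\<lambda>_. c"])
    show "(\<lambda>p. g (V j (snd p))) \<in> borel_measurable (borel \<Otimes>\<^sub>M H)" if "1 \<le> j" for j
      using V_meas[OF that] by measurable
    show "indep_vars (\<lambda>_. borel) (\<lambda>j \<omega>. g (V j \<omega>)) {1..}"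
      by (rule indep_vars_compose2[OF V_indep]) simp
  qed (use g_le Eg in auto)
  also have "\<dots> = exp (of_real m * (c - 1))"
    using poisson_generating_function[OF prob_space_axioms measurable_from_subalg[OF G N] c_le pois]
    by (simp add: m_def)
  also have "of_real m * (c - 1) = (CLINT u:{0..1}|\<Lambda>. g u - 1)"
  proof -
    have "set_integrable \<Lambda> {0..1} f"
      if [measurable]: "f \<in> borel_measurable borel" and f_le: "\<And>u. norm (f u) \<le> 1" for f :: "real \<Rightarrow> complex"
      unfolding set_integrable_def
    proof (rule Bochner_Integration.integrable_bound)
      show "integrable \<Lambda> (\<lambda>u. indicator {0..1} u :: real)"
        using \<Lambda> by (intro integrable_real_indicator) auto
    qed (use f_le in \<open>auto split: split_indicator\<close>)
    then have "set_integrable \<Lambda> {0..1} (\<lambda>_. 1 :: complex)" "set_integrable \<Lambda> {0..1} g"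
      using g_le by auto
    then have "(CLINT u:{0..1}|\<Lambda>. g u - 1) = (CLINT u:{0..1}|\<Lambda>. g u) - (CLINT u:{0..1}|\<Lambda>. 1)"
      by (intro set_integral_diff) auto
    also have "(CLINT u:{0..1}|\<Lambda>. 1) = complex_of_real m"
      using \<Lambda> by (simp add: set_lebesgue_integral_def m_def scaleR_conv_of_real)
    finally show ?thesis using m by (simp add: c_def algebra_simps)
  qed
  finally show ?thesis .
qed

section \<open>Generated sigma-algebras\<close>

definition seq_algebra :: "'a measure \<Rightarrow> 'b measure \<Rightarrow> (nat \<Rightarrow> 'a \<Rightarrow> 'b) \<Rightarrow> 'a measure" where
  "seq_algebra P S X = vimage_algebra (space P) (\<lambda>\<omega>. \<lambda>j\<in>{1..}. X j \<omega>) (PiM {1..} (\<lambda>_. S))"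

lemma sets_seq_algebra: "sets (seq_algebra P S X) = seq_sigma P S X"
  by (simp add: seq_algebra_def seq_sigma_def)

lemma subalgebra_vimage_algebra:
  assumes "f \<in> measurable P N"
  shows "subalgebra P (vimage_algebra (space P) f N)"
  using sets_image_in_sets[OF refl assms] by (simp add: subalgebra_def)

lemma subalgebra_seq_algebra:
  assumes "\<And>j. 1 \<le> j \<Longrightarrow> X j \<in> measurable P S"
  shows "subalgebra P (seq_algebra P S X)"
  unfolding seq_algebra_def
  by (intro subalgebra_vimage_algebra measurable_restrict) (use assms in auto)

lemma measurable_seq_algebra:
  assumes X: "\<And>j. 1 \<le> j \<Longrightarrow> X j \<in> measurable P S" and j: "1 \<le> j"
  shows "X j \<in> measurable (seq_algebra P S X) S"
proof -
  have "(\<lambda>\<omega>. \<lambda>j\<in>{1..}. X j \<omega>) \<in> measurable (seq_algebra P S X) (PiM {1..} (\<lambda>_. S))"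
    unfolding seq_algebra_def
    by (rule measurable_vimage_algebra1) (use X[THEN measurable_space] in \<open>auto simp: space_PiM\<close>)
  from measurable_compose[OF this measurable_component_singleton[of j]] j
  show ?thesis by simp
qed

lemma (in prob_space) indep_set_collect_sigma:
  assumes "indep_sets E K" "\<And>i. i \<in> K \<Longrightarrow> Int_stable (E i)" "I \<subseteq> K" "J \<subseteq> K" "I \<inter> J = {}"
  shows "indep_set (sigma_sets (space M) (\<Union>i\<in>I. E i)) (sigma_sets (space M) (\<Union>i\<in>J. E i))"
proof -
  have "indep_sets (\<lambda>b. sigma_sets (space M) (\<Union>i\<in>case_bool I J b. E i)) UNIV"
    using assms
    by (intro indep_sets_collect_sigma indep_sets_mono_index[OF _ assms(1)])
       (auto simp: disjoint_family_on_def split: bool.splits)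
  then show ?thesis
    unfolding indep_set_def by (rule indep_sets_mono_sets) (auto split: bool.splits)
qed

lemma (in sigma_finite_subalgebra) real_cond_exp_complex_intg:
  fixes f :: "'a \<Rightarrow> complex"
  assumes f: "f \<in> borel_measurable F" and g [measurable]: "g \<in> borel_measurable M"
    and int: "integrable M (\<lambda>\<omega>. f \<omega> * of_real (g \<omega>))"
  shows "(\<integral>\<omega>. f \<omega> * of_real (real_cond_exp M F g \<omega>) \<partial>M) = (\<integral>\<omega>. f \<omega> * of_real (g \<omega>) \<partial>M)"
proof -
  have split: "f \<omega> * of_real h = of_real (Re (f \<omega>) * h) + \<i> * of_real (Im (f \<omega>) * h)" for \<omega> h
    by (simp add: complex_eq_iff)
  have "integrable M (\<lambda>\<omega>. Re (f \<omega> * of_real (g \<omega>)))" "integrable M (\<lambda>\<omega>. Im (f \<omega> * of_real (g \<omega>)))"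
    by (intro integrable_Re integrable_Im int)+
  then have i: "integrable M (\<lambda>\<omega>. Re (f \<omega>) * g \<omega>)" "integrable M (\<lambda>\<omega>. Im (f \<omega>) * g \<omega>)"
    by simp_all
  have "(\<lambda>\<omega>. Re (f \<omega>)) \<in> borel_measurable F" "(\<lambda>\<omega>. Im (f \<omega>)) \<in> borel_measurable F"
    using f by measurable
  note re = real_cond_exp_intg[OF i(1) this(1) g] and im = real_cond_exp_intg[OF i(2) this(2) g]
  have "(\<integral>\<omega>. f \<omega> * of_real (h \<omega>) \<partial>M) =
      of_real (\<integral>\<omega>. Re (f \<omega>) * h \<omega> \<partial>M) + \<i> * of_real (\<integral>\<omega>. Im (f \<omega>) * h \<omega> \<partial>M)"
    if "integrable M (\<lambda>\<omega>. Re (f \<omega>) * h \<omega>)" "integrable M (\<lambda>\<omega>. Im (f \<omega>) * h \<omega>)" for h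
    unfolding split using that
    by (subst Bochner_Integration.integral_add) (auto simp del: of_real_mult)
  from this[OF re(1) im(1)] this[OF i] show ?thesis
    unfolding re(2) im(2) by simp
qed

lemma iexp_sum: "iexp (x * (\<Sum>j\<in>I. f j)) = (\<Prod>j\<in>I. iexp (x * f j))"
proof (cases "finite I")
  case True
  then show ?thesis by (simp add: sum_distrib_left exp_sum)
qed simp

section \<open>The Poisson cluster model\<close>

text \<open>
  The standing assumptions of the Poisson cluster model, with an auxiliary sequence \<open>V\<close> of
  points sampled independently from \<open>\<Lambda>\<close> on \<open>[0, 1]\<close>.
\<close>
locale poisson_cluster_model = prob_space P for P :: "'a measure" +
  fixes \<Lambda> :: "real measure" and \<nu> :: "(real \<times> real) measure"
    and T :: "nat \<Rightarrow> 'a \<Rightarrow> ereal" and L :: "nat \<Rightarrow> real \<Rightarrow> 'a \<Rightarrow> real"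
    and V :: "nat \<Rightarrow> 'a \<Rightarrow> real"
  assumes poisson: "poisson_process \<Lambda> T"
    and mass_pos: "0 < emeasure \<Lambda> {0..1}"
    and levy: "pure_jump_levy_measure \<nu>"
    and additive: "\<And>j. 1 \<le> j \<Longrightarrow> additive_process (L j)"
    and char_L: "\<And>j r y. 1 \<le> j \<Longrightarrow> 0 \<le> r \<Longrightarrow>
           char (distr P borel (L j r)) y = exp (jump_exponent \<nu> {0<..r} y)"
    and iid_L: "iid path_space (\<lambda>j \<omega> r. L j r \<omega>)"
    and iid_V: "iid borel V"
    and V_law: "\<And>j. 1 \<le> j \<Longrightarrow> distr P borel (V j) = uniform_measure \<Lambda> {0..1}"
    and indep: "indep_seqs3 borel T path_space (\<lambda>j \<omega> r. L j r \<omega>) borel V"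
begin

abbreviation N :: "'a \<Rightarrow> nat" where "N \<equiv> point_count T {..1}"
abbreviation T_algebra :: "'a measure" where "T_algebra \<equiv> seq_algebra P borel T"
abbreviation V_algebra :: "'a measure" where "V_algebra \<equiv> seq_algebra P borel V"
abbreviation L_algebra :: "'a measure" where "L_algebra \<equiv> seq_algebra P path_space (\<lambda>j \<omega> r. L j r \<omega>)"
abbreviation TV_algebra :: "'a measure" where
  "TV_algebra \<equiv> sigma (space P) (sets T_algebra \<union> sets V_algebra)"

lemma T_meas: "1 \<le> j \<Longrightarrow> T j \<in> borel_measurable P"
  using poisson by (auto simp: poisson_process_def)

lemma V_meas: "1 \<le> j \<Longrightarrow> V j \<in> borel_measurable P"
  using iid_V by (auto simp: iid_def indep_vars_def)

lemma path_meas: "1 \<le> j \<Longrightarrow> (\<lambda>\<omega> r. L j r \<omega>) \<in> measurable P path_space"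
  using iid_L by (auto simp: iid_def indep_vars_def)

lemma \<Lambda>_sets: "sets \<Lambda> = sets borel" and mass_finite: "emeasure \<Lambda> {0..1} < \<infinity>"
  using poisson by (auto simp: poisson_process_def locally_finite_mean_measure_def)

lemma subalgebras:
  "subalgebra P T_algebra" "subalgebra P V_algebra" "subalgebra P L_algebra" "subalgebra P TV_algebra"
proof -
  show T: "subalgebra P T_algebra" and V: "subalgebra P V_algebra" and "subalgebra P L_algebra"
    using subalgebra_seq_algebra[of T P borel] subalgebra_seq_algebra[of V P borel]
      subalgebra_seq_algebra[of "\<lambda>j \<omega> r. L j r \<omega>" P path_space] T_meas V_meas path_meas
    by simp_all
  have sub: "sets T_algebra \<union> sets V_algebra \<subseteq> sets P"
    using T V by (simp add: subalgebra_def)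
  show "subalgebra P TV_algebra"
    using sets.sigma_sets_subset[OF sub] order_trans[OF sub sets.space_closed]
    by (simp add: subalgebra_def)
qed

lemma indep_T_V: "indep_set (sets T_algebra) (sets V_algebra)"
  and indep_TV_L: "indep_set (sets TV_algebra) (sets L_algebra)"
proof -
  let ?E = "(!) [sets T_algebra, sets L_algebra, sets V_algebra]"
  have E: "indep_sets ?E {0, 1, 2}"
    using indep unfolding indep_seqs3_def by (simp add: sets_seq_algebra)
  have st: "Int_stable (?E i)" if "i \<in> {0, 1, 2}" for i
    using that by (auto intro: sets.Int_stable)
  have gen: "sigma_sets (space P) (sets H) = sets H" if "subalgebra P H" for H
    using that sets.sigma_sets_eq[of H] by (simp add: subalgebra_def)
  have "indep_set (sigma_sets (space P) (\<Union>i\<in>{0}. ?E i)) (sigma_sets (space P) (\<Union>i\<in>{2}. ?E i))"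
    by (rule indep_set_collect_sigma[OF E st]) auto
  then show "indep_set (sets T_algebra) (sets V_algebra)"
    by (simp add: gen subalgebras)
  have "indep_set (sigma_sets (space P) (\<Union>i\<in>{0, 2}. ?E i)) (sigma_sets (space P) (\<Union>i\<in>{1}. ?E i))"
    by (rule indep_set_collect_sigma[OF E st]) auto
  moreover have "sets T_algebra \<union> sets V_algebra \<subseteq> Pow (space P)"
    using subalgebras(1,2) sets.space_closed[of P] by (auto simp: subalgebra_def)
  ultimately show "indep_set (sets TV_algebra) (sets L_algebra)"
    by (simp add: gen subalgebras)
qed

lemma measurable_TV:
  assumes "f \<in> measurable T_algebra S \<or> f \<in> measurable V_algebra S"
  shows "f \<in> measurable TV_algebra S"
proof -
  have sp: "sets T_algebra \<union> sets V_algebra \<subseteq> Pow (space P)" "space T_algebra = space P" "space V_algebra = space P"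
    using subalgebras(1,2) sets.space_closed[of P] by (auto simp: subalgebra_def)
  show ?thesis
    using assms sp by (auto simp: measurable_def intro: sigma_sets.Basic)
qed

lemma N_meas: "N \<in> measurable T_algebra (count_space UNIV)"
  by (intro measurable_point_count measurable_seq_algebra T_meas) auto

lemma L_meas:
  assumes "1 \<le> j"
  shows "L j r \<in> borel_measurable L_algebra"
proof -
  have "(\<lambda>\<omega> r. L j r \<omega>) \<in> measurable L_algebra path_space"
    using assms by (intro measurable_seq_algebra[where X="\<lambda>j \<omega> r. L j r \<omega>"] path_meas)
  from measurable_compose[OF this measurable_component_singleton[of r]] show ?thesis by simp
qed

lemma L_jointly_meas:
  assumes j: "1 \<le> j"
  shows "(\<lambda>p. L j (fst p) (snd p)) \<in> borel_measurable (borel \<Otimes>\<^sub>M L_algebra)"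
proof (rule right_continuous_jointly_measurable[OF L_meas[OF j]])
  fix r \<omega> assume "\<omega> \<in> space L_algebra"
  then have "\<omega> \<in> space P" using subalgebras(3) by (simp add: subalgebra_def)
  then show "continuous (at_right r) (\<lambda>r. L j r \<omega>)"
    using additive[OF j] by (simp add: additive_process_def cadlag_def)
qed


lemma ident_L_algebra: "(\<lambda>\<omega>. \<omega>) \<in> measurable P L_algebra"
  using measurable_from_subalg[OF subalgebras(3) measurable_ident] by (simp add: id_def)

lemma L_at_random_time:
  assumes j: "1 \<le> j" and \<tau> [measurable]: "\<tau> \<in> borel_measurable P"
  shows "(\<lambda>\<omega>. L j (\<tau> \<omega>) \<omega>) \<in> borel_measurable P"
proof -
  note ident_L_algebra [measurable]
  have "(\<lambda>\<omega>. (\<tau> \<omega>, \<omega>)) \<in> measurable P (borel \<Otimes>\<^sub>M L_algebra)"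
    by measurable
  from measurable_compose[OF this L_jointly_meas[OF j]] show ?thesis by simp
qed

lemma kernel_expectation:
  fixes K :: "real \<Rightarrow> (real \<Rightarrow> real) \<Rightarrow> complex"
  assumes K_path: "\<And>u. K u \<in> borel_measurable path_space"
    and K_joint: "\<And>j. 1 \<le> j \<Longrightarrow>
      (\<lambda>p. K (fst p) (\<lambda>r. L j r (snd p))) \<in> borel_measurable (borel \<Otimes>\<^sub>M L_algebra)"
    and K_le: "\<And>u p. norm (K u p) \<le> 1"
    and g: "\<And>j u. 1 \<le> j \<Longrightarrow> expectation (\<lambda>\<omega>. K u (\<lambda>r. L j r \<omega>)) = g u"
  shows "g \<in> borel_measurable borel" and "norm (g u) \<le> 1"
proof -
  show "g \<in> borel_measurable borel"
  proof -
    note ident_L_algebra [measurable]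
    have "(\<lambda>p. (fst p, snd p)) \<in> measurable (borel \<Otimes>\<^sub>M P) (borel \<Otimes>\<^sub>M L_algebra)"
      by measurable
    from measurable_compose[OF this K_joint[of 1]]
    have "(\<lambda>u. expectation (\<lambda>\<omega>. K u (\<lambda>r. L 1 r \<omega>))) \<in> borel_measurable borel"
      by (intro borel_measurable_lebesgue_integral) (simp add: case_prod_beta')
    then show ?thesis by (simp add: g)
  qed
  show "norm (g u) \<le> 1" for u
  proof -
    have "(\<lambda>\<omega>. K u (\<lambda>r. L 1 r \<omega>)) \<in> borel_measurable P"
      using measurable_compose[OF path_meas[of 1] K_path] by simp
    then have "expectation (\<lambda>\<omega>. norm (K u (\<lambda>r. L 1 r \<omega>))) \<le> 1"
      using K_le by (intro integral_le_const integrable_const_bound[where B=1]) auto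
    then have "norm (expectation (\<lambda>\<omega>. K u (\<lambda>r. L 1 r \<omega>))) \<le> 1"
      by (rule order_trans[OF integral_norm_bound])
    then show ?thesis
      by (simp add: g del: One_nat_def)
  qed
qed

text \<open>
  The kernel \<open>K\<close> attaches to a point \<open>u\<close> a functional of the cluster that starts at \<open>u\<close>. Averaging over
  the clusters leaves \<open>g\<close>, and then the generating functionals of the Poisson points and of the sampled
  points coincide.
\<close>
lemma cluster_functional:
  fixes K :: "real \<Rightarrow> (real \<Rightarrow> real) \<Rightarrow> complex"
  assumes K_path: "\<And>u. K u \<in> borel_measurable path_space"
    and K_joint: "\<And>j. 1 \<le> j \<Longrightarrow>
      (\<lambda>p. K (fst p) (\<lambda>r. L j r (snd p))) \<in> borel_measurable (borel \<Otimes>\<^sub>M L_algebra)"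
    and K_le: "\<And>u p. norm (K u p) \<le> 1"
    and g: "\<And>j u. 1 \<le> j \<Longrightarrow> expectation (\<lambda>\<omega>. K u (\<lambda>r. L j r \<omega>)) = g u"
  shows "expectation (\<lambda>\<omega>. \<Prod>j = 1..N \<omega>. K (real_of_ereal (T j \<omega>)) (\<lambda>r. L j r \<omega>)) =
      exp (CLINT u:{0..1}|\<Lambda>. g u - 1)"
    and "expectation (\<lambda>\<omega>. \<Prod>j = 1..N \<omega>. K (V j \<omega>) (\<lambda>r. L j r \<omega>)) =
      exp (CLINT u:{0..1}|\<Lambda>. g u - 1)"
proof -
  have K_indep: "indep_vars (\<lambda>_. borel) (\<lambda>j \<omega>. K (u j) (\<lambda>r. L j r \<omega>)) {1..}" for u :: "nat \<Rightarrow> real"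
    using iid_L
    by (intro indep_vars_compose2[where X="\<lambda>j \<omega> r. L j r \<omega>" and Y="\<lambda>j. K (u j)", OF _ K_path])
      (simp add: iid_def)
  have N_TV: "N \<in> measurable TV_algebra (count_space UNIV)"
    using N_meas measurable_TV by blast
  have marks: "expectation (\<lambda>\<omega>. \<Prod>j = 1..N \<omega>. K (U j \<omega>) (\<lambda>r. L j r \<omega>)) =
      expectation (\<lambda>\<omega>. \<Prod>j = 1..N \<omega>. g (U j \<omega>))"
    if "\<And>j. 1 \<le> j \<Longrightarrow> U j \<in> borel_measurable TV_algebra" for U
    by (rule expectation_prod_marks[OF subalgebras(4,3) indep_TV_L N_TV that,
          where K="\<lambda>j u \<omega>. K u (\<lambda>r. L j r \<omega>)"])
       (use K_joint K_le K_indep g in auto)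
  note g_meas = kernel_expectation(1)[OF K_path K_joint K_le g]
    and g_le = kernel_expectation(2)[OF K_path K_joint K_le g]
  show "expectation (\<lambda>\<omega>. \<Prod>j = 1..N \<omega>. K (real_of_ereal (T j \<omega>)) (\<lambda>r. L j r \<omega>)) =
      exp (CLINT u:{0..1}|\<Lambda>. g u - 1)"
  proof (subst marks)
    fix j :: nat assume "1 \<le> j"
    then have "T j \<in> borel_measurable TV_algebra"
      using measurable_TV measurable_seq_algebra[of T P borel j] T_meas by blast
    then show "(\<lambda>\<omega>. real_of_ereal (T j \<omega>)) \<in> borel_measurable TV_algebra" by measurable
  qed (rule poisson_process_functional[OF poisson g_meas g_le])
  show "expectation (\<lambda>\<omega>. \<Prod>j = 1..N \<omega>. K (V j \<omega>) (\<lambda>r. L j r \<omega>)) =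
      exp (CLINT u:{0..1}|\<Lambda>. g u - 1)"
  proof (subst marks)
    fix j :: nat assume "1 \<le> j"
    then show "V j \<in> borel_measurable TV_algebra"
      using measurable_TV measurable_seq_algebra[of V P borel j] V_meas by blast
  next
    \<comment> \<open>All points are positive, so \<open>N\<close> also counts the points in \<open>[0, 1]\<close>.\<close>
    have "AE \<omega> in P. N \<omega> = point_count T {0..1} \<omega>"
      using poisson_process_points[OF poisson]
    proof eventually_elim
      fix \<omega> assume "(\<forall>j\<ge>1. 0 < T j \<omega>) \<and> {j. 1 \<le> j \<and> T j \<omega> \<in> ereal ` {..1}} = {1..N \<omega>}"
      then have *: "\<forall>j\<ge>1. 0 < T j \<omega>" by blast
      have "{j. 1 \<le> j \<and> T j \<omega> \<in> ereal ` {..1}} = {j. 1 \<le> j \<and> T j \<omega> \<in> ereal ` {0..1}}"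
      proof -
        have "T j \<omega> \<in> ereal ` {..1} \<longleftrightarrow> T j \<omega> \<in> ereal ` {0..1}" if "1 \<le> j" for j
          using *[rule_format, OF that] by (cases "T j \<omega>") auto
        then show ?thesis by auto
      qed
      then show "N \<omega> = point_count T {0..1} \<omega>" by (simp add: point_count_def)
    qed
    then have "measure P {\<omega> \<in> space P. N \<omega> = k} = measure P {\<omega> \<in> space P. point_count T {0..1} \<omega> = k}" for k
      using measurable_point_count[of T P "{..1}"] measurable_point_count[of T P "{0..1}"] T_meas
      by (intro finite_measure_eq_AE) auto
    then have pois: "measure P {\<omega> \<in> space P. N \<omega> = k} =
        measure \<Lambda> {0..1} ^ k / fact k * exp (- measure \<Lambda> {0..1})" for k
      using poisson_process_count_law[OF poisson, of "{0..1}" 1 k] by simp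
    show "expectation (\<lambda>\<omega>. \<Prod>j = 1..N \<omega>. g (V j \<omega>)) = exp (CLINT u:{0..1}|\<Lambda>. g u - 1)"
      by (rule mixed_binomial_functional[OF subalgebras(1,2) indep_T_V N_meas _ _ V_law
            \<Lambda>_sets mass_pos mass_finite pois g_meas g_le])
         (use iid_V in \<open>auto simp: iid_def intro: measurable_seq_algebra V_meas\<close>)
  qed
qed

text \<open>
  The characteristic function of \<open>L(t + s - u) - L(t - u)\<close>, the increment over \<open>(t, t + s]\<close> of a cluster
  started at \<open>u\<close>.
\<close>
definition increment_char :: "real \<Rightarrow> real \<Rightarrow> real \<Rightarrow> real \<Rightarrow> complex" where
  "increment_char x t s u = exp (jump_exponent \<nu> {t - u<..t + s - u} x)"

text \<open>
  The sum \<open>M'(t)\<close> of the overview: the sampled points replace the ordered points of the process.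
\<close>
definition sampled_cluster :: "real \<Rightarrow> 'a \<Rightarrow> real" where
  "sampled_cluster t \<omega> = (\<Sum>j = 1..N \<omega>. L j (t - V j \<omega>) \<omega>)"

lemma random_sum_meas:
  fixes U :: "nat \<Rightarrow> 'a \<Rightarrow> real"
  assumes U: "\<And>j. 1 \<le> j \<Longrightarrow> U j \<in> borel_measurable P"
  shows "(\<lambda>\<omega>. \<Sum>j = 1..N \<omega>. L j (t - U j \<omega>) \<omega>) \<in> borel_measurable P"
proof -
  have "(\<lambda>\<omega>. L j (t - U j \<omega>) \<omega>) \<in> borel_measurable P" if "1 \<le> j" for j
    using U[OF that] by (intro L_at_random_time[OF that, of "\<lambda>\<omega>. t - U j \<omega>"]) simp
  then have "(\<lambda>\<omega>. \<Sum>j = 1..n. L j (t - U j \<omega>) \<omega>) \<in> borel_measurable P" for n :: nat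
    by (intro borel_measurable_sum) auto
  from measurable_compose_countable[OF this measurable_from_subalg[OF subalgebras(1) N_meas]]
  show ?thesis .
qed

lemma poisson_cluster_meas: "poisson_cluster T L t \<in> borel_measurable P"
proof -
  have "(\<lambda>\<omega>. real_of_ereal (T j \<omega>)) \<in> borel_measurable P" if "1 \<le> j" for j
    using T_meas[OF that] by measurable
  from random_sum_meas[OF this] show ?thesis
    by (simp add: poisson_cluster_def[abs_def])
qed

lemma sampled_cluster_meas: "sampled_cluster t \<in> borel_measurable P"
  using random_sum_meas[OF V_meas] by (simp add: sampled_cluster_def[abs_def])

lemma path_coordinate_meas: "(\<lambda>p. p r) \<in> borel_measurable path_space"
  by (rule measurable_component_singleton) simp

lemma L_shift_jointly_meas:
  assumes "1 \<le> j"
  shows "(\<lambda>p. L j (c - fst p) (snd p)) \<in> borel_measurable (borel \<Otimes>\<^sub>M L_algebra)"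
proof -
  have "(\<lambda>p. (c - fst p, snd p)) \<in> measurable (borel \<Otimes>\<^sub>M L_algebra) (borel \<Otimes>\<^sub>M L_algebra)"
    by measurable
  from measurable_compose[OF this L_jointly_meas[OF assms]] show ?thesis by simp
qed

lemma expectation_value:
  assumes "1 \<le> j"
  shows "expectation (\<lambda>\<omega>. iexp (y * L j r \<omega>)) = exp (jump_exponent \<nu> {0<..r} y)"
  by (rule additive_process_increment_char(2)[OF additive[OF assms] levy char_L[OF assms] order_refl])

lemma expectation_increment:
  assumes j: "1 \<le> j" and s: "0 < s"
  shows "expectation (\<lambda>\<omega>. iexp (x * (L j (t + s - u) \<omega> - L j (t - u) \<omega>))) = increment_char x t s u"
    and "expectation (\<lambda>\<omega>. iexp (x * (L j (t + s - u) \<omega> - L j (t - u) \<omega>)) * iexp (y * L j (t - u) \<omega>)) =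
      increment_char x t s u * exp (jump_exponent \<nu> {0<..t - u} y)"
proof -
  have le: "t - u \<le> t + s - u" using s by simp
  show 1: "expectation (\<lambda>\<omega>. iexp (x * (L j (t + s - u) \<omega> - L j (t - u) \<omega>))) = increment_char x t s u"
    unfolding increment_char_def
    by (rule additive_process_increment_char(1)[OF additive[OF j] levy char_L[OF j] le])
  show "expectation (\<lambda>\<omega>. iexp (x * (L j (t + s - u) \<omega> - L j (t - u) \<omega>)) * iexp (y * L j (t - u) \<omega>)) =
      increment_char x t s u * exp (jump_exponent \<nu> {0<..t - u} y)"
    unfolding additive_process_exp_increment[OF additive[OF j] le] 1
      expectation_value[OF j, of y "t - u"] ..
qed

text \<open>
  As a function of \<open>u\<close> it is an integral of a jointly measurable kernel bounded by 1.
\<close>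
lemma increment_char_regular:
  assumes s: "0 < s"
  shows "increment_char x t s \<in> borel_measurable borel" and "norm (increment_char x t s u) \<le> 1"
proof -
  note [measurable] = path_coordinate_meas
  let ?K = "\<lambda>u p. iexp (x * (p (t + s - u) - p (t - u)))"
  have path: "?K u \<in> borel_measurable path_space" for u by measurable
  have joint: "(\<lambda>p. ?K (fst p) (\<lambda>r. L j r (snd p))) \<in> borel_measurable (borel \<Otimes>\<^sub>M L_algebra)"
    if "1 \<le> j" for j
    using L_shift_jointly_meas[OF that] by measurable
  note reg = kernel_expectation[where K="?K", OF path joint _ expectation_increment(1)[OF _ s]]
  show "increment_char x t s \<in> borel_measurable borel" "norm (increment_char x t s u) \<le> 1"
    by (rule reg; simp del: of_real_mult of_real_diff)+
qed

lemma value_functional_eq: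
  "expectation (\<lambda>\<omega>. iexp (y * poisson_cluster T L t \<omega>)) =
   expectation (\<lambda>\<omega>. iexp (y * sampled_cluster t \<omega>))"
proof -
  note [measurable] = path_coordinate_meas
  define K where "K u p = iexp (y * p (t - u))" for u and p :: "real \<Rightarrow> real"
  have "iexp (y * poisson_cluster T L t \<omega>) = (\<Prod>j = 1..N \<omega>. K (real_of_ereal (T j \<omega>)) (\<lambda>r. L j r \<omega>))" for \<omega>
    unfolding poisson_cluster_def iexp_sum K_def ..
  moreover have "iexp (y * sampled_cluster t \<omega>) = (\<Prod>j = 1..N \<omega>. K (V j \<omega>) (\<lambda>r. L j r \<omega>))" for \<omega>
    unfolding sampled_cluster_def iexp_sum K_def ..
  moreover have path: "K u \<in> borel_measurable path_space" for u
    unfolding K_def by measurable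
  moreover have joint: "(\<lambda>p. K (fst p) (\<lambda>r. L j r (snd p))) \<in> borel_measurable (borel \<Otimes>\<^sub>M L_algebra)"
    if "1 \<le> j" for j
    using L_shift_jointly_meas[OF that] unfolding K_def by measurable
  moreover have le: "norm (K u p) \<le> 1" for u p
    by (simp add: K_def del: of_real_mult)
  moreover have E: "expectation (\<lambda>\<omega>. K u (\<lambda>r. L j r \<omega>)) = exp (jump_exponent \<nu> {0<..t - u} y)"
    if "1 \<le> j" for j u
    unfolding K_def by (rule expectation_value[OF that])
  ultimately show ?thesis
    using cluster_functional[OF path joint le E] by simp
qed

text \<open>
  The decisive identity. Both sides are generating functionals of the same \<open>g\<close>: on the left the increment
  and the value at \<open>t\<close> of each cluster are averaged together and factor by independence of increments; on
  the right the increment has been averaged already and only the value is random.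
\<close>
lemma increment_functional_eq:
  assumes s: "0 < s"
  shows "expectation (\<lambda>\<omega>. iexp (x * (poisson_cluster T L (t + s) \<omega> - poisson_cluster T L t \<omega>)) *
      iexp (y * poisson_cluster T L t \<omega>)) =
    expectation (\<lambda>\<omega>. (\<Prod>j = 1..N \<omega>. increment_char x t s (V j \<omega>)) * iexp (y * sampled_cluster t \<omega>))"
proof -
  note [measurable] = path_coordinate_meas increment_char_regular(1)[OF s]
  let ?g = "\<lambda>u. increment_char x t s u * exp (jump_exponent \<nu> {0<..t - u} y)"
  define K1 where "K1 u p = iexp (x * (p (t + s - u) - p (t - u))) * iexp (y * p (t - u))"
    for u and p :: "real \<Rightarrow> real"
  define K2 where "K2 u p = increment_char x t s u * iexp (y * p (t - u))" for u and p :: "real \<Rightarrow> real"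
  have path: "K1 u \<in> borel_measurable path_space" "K2 u \<in> borel_measurable path_space" for u
    unfolding K1_def K2_def by measurable
  have joint: "(\<lambda>p. K1 (fst p) (\<lambda>r. L j r (snd p))) \<in> borel_measurable (borel \<Otimes>\<^sub>M L_algebra)"
    "(\<lambda>p. K2 (fst p) (\<lambda>r. L j r (snd p))) \<in> borel_measurable (borel \<Otimes>\<^sub>M L_algebra)" if "1 \<le> j" for j
    using L_shift_jointly_meas[OF that] unfolding K1_def K2_def by measurable
  have le: "norm (K1 u p) \<le> 1" "norm (K2 u p) \<le> 1" for u p
    using increment_char_regular(2)[OF s]
    by (simp_all add: K1_def K2_def norm_mult del: of_real_mult of_real_diff)
  have E: "expectation (\<lambda>\<omega>. K1 u (\<lambda>r. L j r \<omega>)) = ?g u" "expectation (\<lambda>\<omega>. K2 u (\<lambda>r. L j r \<omega>)) = ?g u"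
    if "1 \<le> j" for j u
    using expectation_increment(2)[OF that s] expectation_value[OF that]
    by (simp_all add: K1_def K2_def del: of_real_mult of_real_diff)
  have "iexp (x * (poisson_cluster T L (t + s) \<omega> - poisson_cluster T L t \<omega>)) * iexp (y * poisson_cluster T L t \<omega>) =
      (\<Prod>j = 1..N \<omega>. K1 (real_of_ereal (T j \<omega>)) (\<lambda>r. L j r \<omega>))" for \<omega>
    unfolding poisson_cluster_def sum_subtractf[symmetric] iexp_sum prod.distrib[symmetric] K1_def ..
  moreover have "(\<Prod>j = 1..N \<omega>. increment_char x t s (V j \<omega>)) * iexp (y * sampled_cluster t \<omega>) =
      (\<Prod>j = 1..N \<omega>. K2 (V j \<omega>) (\<lambda>r. L j r \<omega>))" for \<omega>
    unfolding sampled_cluster_def iexp_sum prod.distrib[symmetric] K2_def ..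
  ultimately show ?thesis
    using cluster_functional(1)[OF path(1) joint(1) le(1) E(1)]
      cluster_functional(2)[OF path(2) joint(2) le(2) E(2)] by simp
qed

text \<open>
  The previous identity holds for all \<open>y\<close>, so it is an equality of Fourier transforms of two complex
  measures on the line; the measures then agree on \<open>A\<close>.
\<close>
lemma increment_on_event:
  assumes s: "0 < s" and A: "A \<in> sets borel"
  shows "expectation (\<lambda>\<omega>. iexp (x * (poisson_cluster T L (t + s) \<omega> - poisson_cluster T L t \<omega>)) *
      indicator A (poisson_cluster T L t \<omega>)) =
    expectation (\<lambda>\<omega>. (\<Prod>j = 1..N \<omega>. increment_char x t s (V j \<omega>)) * indicator A (sampled_cluster t \<omega>))"
proof (rule complex_weighted_law_unique[OF poisson_cluster_meas sampled_cluster_meas _ _ _ _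
      increment_functional_eq[OF s] value_functional_eq A])
  note [measurable] = poisson_cluster_meas
  show "(\<lambda>\<omega>. iexp (x * (poisson_cluster T L (t + s) \<omega> - poisson_cluster T L t \<omega>))) \<in> borel_measurable P"
    by measurable
  show "(\<lambda>\<omega>. \<Prod>j = 1..N \<omega>. increment_char x t s (V j \<omega>)) \<in> borel_measurable P"
    by (intro measurable_prod_random_length measurable_from_subalg[OF subalgebras(1) N_meas]
        measurable_compose[OF V_meas increment_char_regular(1)[OF s]])
  show "norm (\<Prod>j = 1..N \<omega>. increment_char x t s (V j \<omega>)) \<le> 1" for \<omega>
    by (intro norm_prod_le_1 increment_char_regular(2)[OF s])
qed (simp del: of_real_mult of_real_diff)

lemma value_law_eq:
  assumes A: "A \<in> sets borel"
  shows "prob {\<omega> \<in> space P. poisson_cluster T L t \<omega> \<in> A} = prob {\<omega> \<in> space P. sampled_cluster t \<omega> \<in> A}"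
proof -
  note [measurable] = poisson_cluster_meas sampled_cluster_meas
  have "distr P borel (poisson_cluster T L t) = distr P borel (sampled_cluster t)"
  proof (rule Levy_uniqueness)
    show "char (distr P borel (poisson_cluster T L t)) = char (distr P borel (sampled_cluster t))"
      using value_functional_eq by (simp add: fun_eq_iff char_def integral_distr del: of_real_mult)
  qed auto
  then have "measure (distr P borel (poisson_cluster T L t)) A = measure (distr P borel (sampled_cluster t)) A"
    by simp
  then show ?thesis
    using A by (simp add: measure_distr vimage_def Int_def conj_commute)
qed

end

section \<open>The conditional characteristic function\<close>

theorem lemma2p2:
  fixes P :: "'a measure" and \<Lambda> :: "real measure" and \<nu> :: "(real \<times> real) measure"
    and T :: "nat \<Rightarrow> 'a \<Rightarrow> ereal" and L :: "nat \<Rightarrow> real \<Rightarrow> 'a \<Rightarrow> real"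
    and V :: "nat \<Rightarrow> 'a \<Rightarrow> real" and s t x :: real and A :: "real set"
  assumes "prob_space P"
    and "prob_space.poisson_process P \<Lambda> T"
    and "emeasure \<Lambda> {0..1} > 0"
    and "pure_jump_levy_measure \<nu>"
    and "\<And>j. 1 \<le> j \<Longrightarrow> prob_space.additive_process P (L j)"
    and "\<And>j r y. 1 \<le> j \<Longrightarrow> 0 \<le> r \<Longrightarrow>
           char (distr P borel (L j r)) y = exp (jump_exponent \<nu> {0<..r} y)"
    and "prob_space.iid P path_space (\<lambda>j \<omega> r. L j r \<omega>)"
    and "prob_space.iid P borel V"
    and "\<And>j. 1 \<le> j \<Longrightarrow> distr P borel (V j) = uniform_measure \<Lambda> {0..1}"
    and "prob_space.indep_seqs3 P borel T path_space (\<lambda>j \<omega> r. L j r \<omega>) borel V"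
    and "0 < s" and "1 \<le> t" and "A \<in> sets borel"
    and "\<P>(\<omega> in P. poisson_cluster T L t \<omega> \<in> A) > 0"
  shows "(CLINT \<omega>|uniform_measure P {\<omega> \<in> space P. poisson_cluster T L t \<omega> \<in> A}.
            iexp (x * (poisson_cluster T L (t + s) \<omega> - poisson_cluster T L t \<omega>))) =
         (CLINT \<omega>|P.
            exp (\<Sum>j = 1..point_count T {..1} \<omega>.
                   jump_exponent \<nu> {t - V j \<omega><..t + s - V j \<omega>} x) *
            complex_of_real (real_cond_exp P (count_marks_algebra P T V)
              (indicator {\<omega> \<in> space P.
                 (\<Sum>j = 1..point_count T {..1} \<omega>. L j (t - V j \<omega>) \<omega>) \<in> A}) \<omega>)) /
         complex_of_real (\<P>(\<omega> in P.
            (\<Sum>j = 1..point_count T {..1} \<omega>. L j (t - V j \<omega>) \<omega>) \<in> A))"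
proof -
  interpret poisson_cluster_model P \<Lambda> \<nu> T L V
    using assms(1-10) by (simp add: poisson_cluster_model_def poisson_cluster_model_axioms_def)
  note S_A [measurable] = \<open>A \<in> sets borel\<close> and [measurable] = poisson_cluster_meas sampled_cluster_meas
  let ?\<phi> = "increment_char x t s"
  define D where "D \<omega> = poisson_cluster T L (t + s) \<omega> - poisson_cluster T L t \<omega>" for \<omega>
  have [measurable]: "D \<in> borel_measurable P" unfolding D_def by measurable
  define C where "C = count_marks_algebra P T V"
  define S where "S = {\<omega> \<in> space P. poisson_cluster T L t \<omega> \<in> A}"
  define S' where "S' = {\<omega> \<in> space P. sampled_cluster t \<omega> \<in> A}"
  have S [measurable]: "S \<in> sets P" and S' [measurable]: "S' \<in> sets P"
    unfolding S_def S'_def by measurable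
  have p: "0 < prob S" using assms(14) by (simp add: S_def)
  have p_eq: "prob S = prob S'" unfolding S_def S'_def by (rule value_law_eq[OF S_A])
  define W where "W \<omega> = exp (\<Sum>j = 1..N \<omega>. jump_exponent \<nu> {t - V j \<omega><..t + s - V j \<omega>} x)" for \<omega>
  have W_prod: "W \<omega> = (\<Prod>j = 1..N \<omega>. ?\<phi> (V j \<omega>))" for \<omega>
    by (simp add: W_def increment_char_def exp_sum)
  have W_le: "norm (W \<omega>) \<le> 1" for \<omega>
    unfolding W_prod by (intro norm_prod_le_1 increment_char_regular(2) \<open>0 < s\<close>)
  define f where "f \<omega> = (N \<omega>, \<lambda>j\<in>{1..}. V j \<omega>)" for \<omega>
  define R where "R = (count_space (UNIV :: nat set) \<Otimes>\<^sub>M PiM {1::nat..} (\<lambda>_. borel :: real measure))"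
  have C_eq: "C = vimage_algebra (space P) f R"
    by (simp add: C_def count_marks_algebra_def f_def[abs_def] R_def)
  have "(\<lambda>\<omega>. \<lambda>j\<in>{1..}. V j \<omega>) \<in> measurable P (PiM {1..} (\<lambda>_. borel))"
    by (rule measurable_restrict) (use V_meas in auto)
  then have f: "f \<in> measurable P R"
    unfolding f_def R_def using measurable_from_subalg[OF subalgebras(1) N_meas] by measurable
  have sub: "subalgebra P C"
    unfolding C_eq by (rule subalgebra_vimage_algebra[OF f])
  interpret C: finite_measure_subalgebra P C
    by unfold_locales (rule sub)
  have fC: "f \<in> measurable C R"
    unfolding C_eq by (rule measurable_vimage_algebra1) (use measurable_space[OF f] in auto)
  have N_C: "N \<in> measurable C (count_space UNIV)"
    using measurable_compose[OF fC[unfolded R_def] measurable_fst] by (simp add: f_def)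
  have V_C: "V j \<in> borel_measurable C" if "1 \<le> j" for j
    using measurable_compose[OF measurable_compose[OF fC[unfolded R_def] measurable_snd]
        measurable_component_singleton[of j]] that by (simp add: f_def)
  have W_C: "W \<in> borel_measurable C"
    unfolding W_prod
    by (intro measurable_prod_random_length N_C measurable_compose[OF V_C increment_char_regular(1)] \<open>0 < s\<close>)
  have W [measurable]: "W \<in> borel_measurable P"
    by (rule measurable_from_subalg[OF sub W_C])
  have "(CLINT \<omega>|uniform_measure P S. iexp (x * D \<omega>)) =
      (CLINT \<omega>|P. indicator S \<omega> *\<^sub>R iexp (x * D \<omega>)) / prob S"
    using p by (intro integral_uniform_measure) (auto simp: emeasure_eq_measure)
  also have "(CLINT \<omega>|P. indicator S \<omega> *\<^sub>R iexp (x * D \<omega>)) = (CLINT \<omega>|P. iexp (x * D \<omega>) * indicator A (poisson_cluster T L t \<omega>))"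
    by (intro Bochner_Integration.integral_cong) (auto simp: S_def indicator_def)
  also have "\<dots> = (CLINT \<omega>|P. W \<omega> * indicator A (sampled_cluster t \<omega>))"
    unfolding W_prod D_def by (rule increment_on_event[OF \<open>0 < s\<close> S_A])
  also have "\<dots> = (CLINT \<omega>|P. W \<omega> * complex_of_real (indicator S' \<omega>))"
    by (intro Bochner_Integration.integral_cong) (auto simp: S'_def indicator_def)
  \<comment> \<open>The weight \<open>W\<close> depends only on \<open>N(1)\<close> and the sampled points, so conditioning on them leaves the integral unchanged.\<close>
  also have "\<dots> = (CLINT \<omega>|P. W \<omega> * complex_of_real (real_cond_exp P C (indicator S') \<omega>))"
  proof (rule C.real_cond_exp_complex_intg[OF W_C, symmetric])
    show "integrable P (\<lambda>\<omega>. W \<omega> * complex_of_real (indicator S' \<omega>))"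
      by (rule integrable_const_bound[where B=1]) (auto simp: norm_mult W_le split: split_indicator)
  qed simp
  finally have "(CLINT \<omega>|uniform_measure P S. iexp (x * D \<omega>)) =
      (CLINT \<omega>|P. W \<omega> * complex_of_real (real_cond_exp P C (indicator S') \<omega>)) / prob S'"
    unfolding p_eq .
  then show ?thesis
    by (simp only: S_def S'_def W_def C_def D_def sampled_cluster_def)
qed

end
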